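(* Let $m,n$ be positive integers with $m<n+2$, let $V\in P(n,m)$, $A\subset V$ and $g:A\to V^\perp$. If $A$ is $\mathcal{H}^m$ measurable, $g$ is Lipschitz (with respect to the parabolic metric) and the graph $G=\{p+g(p):p\in A\}$ is LG $m$-rectifiable, then $g$ is parabolically differentiable at $\mathcal{H}^m$ almost all $p\in A$.
   Context: Setting: $\mathbb{P}^n=\mathbb{R}^n\times\mathbb{R}$ with $\|(x,t)\|=\sqrt{|x|^2+|t|}$ and the metric $d(p,q)=\|p-q\|$. $\mathcal{H}^s$ is the Hausdorff measure with respect to $d$, $\mathcal{H}^s(A)=\lim_{\delta\to0}\inf\{\sum_i d(E_i)^s: A\subset\bigcup_i E_i,\ d(E_i)<\delta\}$, $d(E_i)$ being the diameter. Put $H=\mathbb{R}^n\times\{0\}$. Planes: for $1\le m\le n$, $H(n,m)$ is the set of linear $m$-dimensional subspaces of $\mathbb{R}^n\times\{0\}$; for $2\le m\le n+1$, $V(n,m)$ is the set of linear $(m-1)$-dimensional subspaces of $\mathbb{R}^{n+1}$ containing $\{0\}\times\mathbb{R}$; $P(n,m)=H(n,m)\cup V(n,m)$ (one of the two being empty when its index range fails). $V^\perp$ is the orthogonal complement of $V$ in $\mathbb{R}^{n+1}$. Lipschitz: $g$ is $L$-Lipschitz if $\|g(x)-g(y)\|\le L\|x-y\|$ for $x,y\in A$. An $(m,L)$-Lipschitz graph is a set $\{x+g(x):x\in A\}$ with $A\subset V\in P(n,m)$ and $g:A\to V^\perp$ $L$-Lipschitz. A set $E\subset\mathbb{P}^n$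 is LG $m$-rectifiable if for every $0<L<\infty$ there are $(m,L)$-Lipschitz graphs $G_1,G_2,\dots$ with $\mathcal{H}^m(E\setminus\bigcup_iG_i)=0$. Parabolic differentiability: $g:A\to V^\perp$ is parabolically differentiable at $p=(x,t)\in A$ if there is a linear map $\Lambda_p:V\cap H\to V^\perp$ of finite parabolic operator norm, $\sup_{v\ne0}\|\Lambda_p(v)\|/\|v\|<\infty$ (equivalently, with values in $V^\perp\cap H$), such that, with $q=(y,u)$, $\lim_{q\to p,\,q\in A,\,q\neq p}\|g(q)-g(p)-\Lambda_p(y-x)\|/\|q-p\|=0$ (here $y-x$ is identified with $(y-x,0)\in V\cap H$). *)

theory Defs
  imports "HOL-Analysis.Analysis"
begin

text \<open>The space \<open>\<real>\<^sup>n \<times> \<real>\<close> with \<open>n = CARD('n)\<close>. The type class metric (and \<open>norm\<close>, \<open>dist\<close>,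
  \<open>diameter\<close>, \<open>lipschitz_on\<close>) of this product is Euclidean, so the parabolic versions of these
  notions are introduced separately; \<open>subspace\<close>, \<open>dim\<close> and \<open>orthogonal_comp\<close> are the
  Euclidean ones, as intended.\<close>

type_synonym 'n parabolic = "(real ^ 'n) \<times> real"

definition pnorm :: "'n::finite parabolic \<Rightarrow> real" where
  "pnorm p = sqrt ((norm (fst p))\<^sup>2 + \<bar>snd p\<bar>)"

definition pdist :: "'n::finite parabolic \<Rightarrow> 'n parabolic \<Rightarrow> real" where
  "pdist p q = pnorm (p - q)"

definition pdiam :: "'n::finite parabolic set \<Rightarrow> ennreal" where
  "pdiam E = (SUP p\<in>E. SUP q\<in>E. ennreal (pdist p q))"

text \<open>Hausdorff measures are only needed in integer dimensions \<open>m \<ge> 1\<close>, so the exponent is a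
  natural number. Countable covers are sequences; some of the sets may be empty, and these
  contribute \<open>0 ^ m = 0\<close>.\<close>

definition hausdorff_pre :: "nat \<Rightarrow> real \<Rightarrow> 'n::finite parabolic set \<Rightarrow> ennreal" where
  "hausdorff_pre m \<delta> A =
     (INF E\<in>{E :: nat \<Rightarrow> 'n parabolic set. A \<subseteq> (\<Union>i. E i) \<and> (\<forall>i. pdiam (E i) < ennreal \<delta>)}.
        \<Sum>i. pdiam (E i) ^ m)"

definition hausdorff :: "nat \<Rightarrow> 'n::finite parabolic set \<Rightarrow> ennreal" where
  "hausdorff m A = Lim (at_right 0) (\<lambda>\<delta>. hausdorff_pre m \<delta> A)"

text \<open>Measurability is meant in the sense of Caratheodory, for the outer measure \<open>hausdorff m\<close>.\<close>

definition hausdorff_measurable :: "nat \<Rightarrow> 'n::finite parabolic set \<Rightarrow> bool" where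
  "hausdorff_measurable m A \<longleftrightarrow> A \<in> lambda_system UNIV UNIV (hausdorff m)"

definition horizontal :: "'n::finite parabolic set" where
  "horizontal = UNIV \<times> {0}"

definition horizontal_planes :: "nat \<Rightarrow> 'n::finite parabolic set set" where
  "horizontal_planes m =
     {V. 1 \<le> m \<and> m \<le> CARD('n) \<and> subspace V \<and> V \<subseteq> horizontal \<and> dim V = m}"

definition vertical_planes :: "nat \<Rightarrow> 'n::finite parabolic set set" where
  "vertical_planes m =
     {V. 2 \<le> m \<and> m \<le> CARD('n) + 1 \<and> subspace V \<and> {0} \<times> UNIV \<subseteq> V \<and> dim V = m - 1}"

definition planes :: "nat \<Rightarrow> 'n::finite parabolic set set" where
  "planes m = horizontal_planes m \<union> vertical_planes m"

definition parabolic_lipschitz ::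
    "real \<Rightarrow> 'n::finite parabolic set \<Rightarrow> ('n parabolic \<Rightarrow> 'n parabolic) \<Rightarrow> bool" where
  "parabolic_lipschitz L A g \<longleftrightarrow> (\<forall>p\<in>A. \<forall>q\<in>A. pnorm (g p - g q) \<le> L * pnorm (p - q))"

definition graph_over ::
    "'n::finite parabolic set \<Rightarrow> ('n parabolic \<Rightarrow> 'n parabolic) \<Rightarrow> 'n parabolic set" where
  "graph_over A g = {p + g p |p. p \<in> A}"

definition lipschitz_graph :: "nat \<Rightarrow> real \<Rightarrow> 'n::finite parabolic set \<Rightarrow> bool" where
  "lipschitz_graph m L G \<longleftrightarrow>
     (\<exists>V\<in>planes m. \<exists>A\<subseteq>V. \<exists>g. g \<in> A \<rightarrow> orthogonal_comp V \<and> parabolic_lipschitz L A g \<and>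
        G = graph_over A g)"

definition LG_rectifiable :: "nat \<Rightarrow> 'n::finite parabolic set \<Rightarrow> bool" where
  "LG_rectifiable m E \<longleftrightarrow>
     (\<forall>L>0. \<exists>G :: nat \<Rightarrow> 'n parabolic set.
        (\<forall>i. lipschitz_graph m L (G i)) \<and> hausdorff m (E - (\<Union>i. G i)) = 0)"

text \<open>A linear map defined on a subspace \<open>S\<close> only; its values off \<open>S\<close> are irrelevant.\<close>

definition linear_map_on :: "'a::real_vector set \<Rightarrow> ('a \<Rightarrow> 'b::real_vector) \<Rightarrow> bool" where
  "linear_map_on S f \<longleftrightarrow>
     (\<forall>x\<in>S. \<forall>y\<in>S. f (x + y) = f x + f y) \<and> (\<forall>c. \<forall>x\<in>S. f (c *\<^sub>R x) = c *\<^sub>R f x)"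

text \<open>The limit is taken in the product topology, which is the topology of the parabolic
  metric (see \<open>eventually_at_within_parabolic\<close> below). The differential is applied to
  the horizontal part of \<open>q - p\<close>.\<close>

definition parabolically_differentiable ::
    "'n::finite parabolic set \<Rightarrow> 'n parabolic set \<Rightarrow> ('n parabolic \<Rightarrow> 'n parabolic) \<Rightarrow>
      'n parabolic \<Rightarrow> bool" where
  "parabolically_differentiable V A g p \<longleftrightarrow>
     (\<exists>\<Lambda>. \<Lambda> \<in> V \<inter> horizontal \<rightarrow> orthogonal_comp V \<and>
        linear_map_on (V \<inter> horizontal) \<Lambda> \<and>
        bdd_above ((\<lambda>v. pnorm (\<Lambda> v) / pnorm v) ` (V \<inter> horizontal - {0})) \<and>
        ((\<lambda>q. pnorm (g q - g p - \<Lambda> (fst q - fst p, 0)) / pnorm (q - p)) \<longlongrightarrow> 0)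
          (at p within A))"

lemma hausdorff_pre_antimono:
  assumes "\<delta> \<le> \<epsilon>"
  shows "hausdorff_pre m \<epsilon> A \<le> hausdorff_pre m \<delta> A"
  unfolding hausdorff_pre_def
  by (rule INF_superset_mono) (auto intro: less_le_trans ennreal_leI[OF assms])

lemma hausdorff_pre_tendsto:
  "((\<lambda>\<delta>. hausdorff_pre m \<delta> A) \<longlongrightarrow> (SUP \<delta>\<in>{0<..}. hausdorff_pre m \<delta> A)) (at_right 0)"
proof (rule increasing_tendsto)
  show "\<forall>\<^sub>F \<delta> in at_right 0. hausdorff_pre m \<delta> A \<le> (SUP \<delta>\<in>{0<..}. hausdorff_pre m \<delta> A)"
    using eventually_at_right_less[of "0::real"] by eventually_elim (auto intro!: SUP_upper)
next
  fix x assume "x < (SUP \<delta>\<in>{0<..}. hausdorff_pre m \<delta> A)"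
  then obtain \<epsilon> where \<epsilon>: "\<epsilon> > 0" "x < hausdorff_pre m \<epsilon> A"
    by (auto simp: less_SUP_iff)
  have "\<forall>\<^sub>F \<delta> in at_right 0. \<delta> < \<epsilon>"
    using \<epsilon>(1) by (auto simp: eventually_at_right_field)
  then show "\<forall>\<^sub>F \<delta> in at_right 0. x < hausdorff_pre m \<delta> A"
    by (rule eventually_mono) (meson \<epsilon>(2) hausdorff_pre_antimono less_imp_le less_le_trans)
qed

lemma hausdorff_eq_SUP: "hausdorff m A = (SUP \<delta>\<in>{0<..}. hausdorff_pre m \<delta> A)"
  unfolding hausdorff_def by (intro tendsto_Lim hausdorff_pre_tendsto) simp

lemma tendsto_parabolic_iff:
  "(f \<longlongrightarrow> p) F \<longleftrightarrow> ((\<lambda>x. pdist (f x) p) \<longlongrightarrow> 0) F"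
proof
  assume "(f \<longlongrightarrow> p) F"
  then have "((\<lambda>x. sqrt ((norm (fst (f x - p)))\<^sup>2 + \<bar>snd (f x - p)\<bar>)) \<longlongrightarrow>
      sqrt ((norm (fst (p - p)))\<^sup>2 + \<bar>snd (p - p)\<bar>)) F"
    by (intro tendsto_intros)
  then show "((\<lambda>x. pdist (f x) p) \<longlongrightarrow> 0) F"
    by (simp add: pdist_def pnorm_def)
next
  assume *: "((\<lambda>x. pdist (f x) p) \<longlongrightarrow> 0) F"
  have 1: "norm (fst (f x) - fst p) \<le> pdist (f x) p" for x
    unfolding pdist_def pnorm_def by (rule real_le_rsqrt) auto
  have 2: "norm (snd (f x) - snd p) \<le> (pdist (f x) p)\<^sup>2" for x
    unfolding pdist_def pnorm_def by auto
  have "((\<lambda>x. fst (f x) - fst p) \<longlongrightarrow> 0) F"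
    by (rule Lim_null_comparison[OF _ *]) (use 1 in auto)
  moreover have "((\<lambda>x. (pdist (f x) p)\<^sup>2) \<longlongrightarrow> 0) F"
    using tendsto_power[OF *, of 2] by simp
  then have "((\<lambda>x. snd (f x) - snd p) \<longlongrightarrow> 0) F"
    by (rule Lim_null_comparison[rotated]) (use 2 in auto)
  ultimately have "((\<lambda>x. fst (f x)) \<longlongrightarrow> fst p) F" "((\<lambda>x. snd (f x)) \<longlongrightarrow> snd p) F"
    by (auto simp: Lim_null[of _ "fst p"] Lim_null[of _ "snd p"])
  then show "(f \<longlongrightarrow> p) F"
    using tendsto_Pair by fastforce
qed

lemma eventually_at_within_parabolic:
  "eventually P (at p within A) \<longleftrightarrow> (\<exists>d>0. \<forall>q\<in>A. q \<noteq> p \<and> pdist q p < d \<longrightarrow> P q)"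
proof
  assume "eventually P (at p within A)"
  show "\<exists>d>0. \<forall>q\<in>A. q \<noteq> p \<and> pdist q p < d \<longrightarrow> P q"
  proof (rule ccontr)
    assume "\<not> ?thesis"
    then have "\<forall>k. \<exists>q\<in>A. q \<noteq> p \<and> pdist q p < 1 / real (Suc k) \<and> \<not> P q"
      by (metis of_nat_0_less_iff zero_less_Suc zero_less_divide_1_iff)
    then obtain q where q: "\<And>k. q k \<in> A" "\<And>k. q k \<noteq> p" "\<And>k. \<not> P (q k)"
      "\<And>k. pdist (q k) p < 1 / real (Suc k)" by metis
    have "pdist (q k) p \<ge> 0" for k by (simp add: pdist_def pnorm_def)
    then have "(\<lambda>k. pdist (q k) p) \<longlonglongrightarrow> 0"
      by (intro Lim_null_comparison[OF _ LIMSEQ_inverse_real_of_nat])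
        (use q(4) in \<open>auto simp: inverse_eq_divide less_imp_le\<close>)
    then have "filterlim q (at p within A) sequentially"
      using q by (auto simp: filterlim_at tendsto_parabolic_iff)
    with \<open>eventually P _\<close> have "\<forall>\<^sub>F k in sequentially. P (q k)"
      by (simp add: filterlim_iff)
    with q(3) show False by simp
  qed
next
  assume "\<exists>d>0. \<forall>q\<in>A. q \<noteq> p \<and> pdist q p < d \<longrightarrow> P q"
  then obtain d where d: "d > 0" "\<And>q. q \<in> A \<Longrightarrow> q \<noteq> p \<Longrightarrow> pdist q p < d \<Longrightarrow> P q" by blast
  have "((\<lambda>q. pdist q p) \<longlongrightarrow> 0) (at p within A)"
    by (subst tendsto_parabolic_iff[of "\<lambda>q. q" p, symmetric]) (rule tendsto_ident_at)
  then have "\<forall>\<^sub>F q in at p within A. pdist q p < d"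
    by (rule order_tendstoD) (rule d)
  moreover have "\<forall>\<^sub>F q in at p within A. q \<in> A \<and> q \<noteq> p"
    by (auto simp: eventually_at_filter)
  ultimately show "eventually P (at p within A)"
    by eventually_elim (use d in blast)
qed

end

theory Submission
  imports Defs
begin

text \<open>For each small \<open>\<epsilon>\<close>, almost every \<open>p \<in> A\<close> lies in a set \<open>B \<subseteq> A\<close> whose graph is contained in an
  \<open>(m, \<epsilon>)\<close>-Lipschitz graph over some plane \<open>V'\<close>, and \<open>B\<close> is not porous in \<open>V\<close> at \<open>p\<close>: near \<open>p\<close>, every
  point of \<open>V\<close> at distance \<open>r\<close> from \<open>p\<close> has a point of \<open>B\<close> within \<open>o(r)\<close>. Chords of the graph over \<open>B\<close> are
  \<open>\<epsilon>\<close>-close to \<open>V'\<close>, and their projections to \<open>V\<close> approximate every direction of \<open>V\<close>; hence \<open>V'\<close> is of the same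
  type as \<open>V\<close> and is the graph of a linear map on the horizontal part of \<open>V\<close> whose norm is bounded in
  terms of the Lipschitz constant only. This map approximates \<open>g\<close> at \<open>p\<close> with relative error \<open>O(\<epsilon>)\<close>,
  first on \<open>B\<close> and then, by the Lipschitz condition, on \<open>A\<close>. A limit as \<open>\<epsilon> \<rightarrow> 0\<close> is the differential.

  That porosity is negligible for \<open>\<H>\<^sup>m\<close> follows from a Vitali covering argument for the projection
  to \<open>V\<close> of Lebesgue measure on a tube around \<open>V\<close>. This measure is doubling and gives balls of radius
  \<open>r \<le> 1\<close> at least \<open>c r\<^sup>m\<close>, so that its null subsets of \<open>V\<close> are \<open>\<H>\<^sup>m\<close>-null.\<close>

section \<open>The parabolic norm\<close>

lemma pnorm_0 [simp]: "pnorm 0 = 0"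
  by (simp add: pnorm_def)

lemma pnorm_nonneg [simp]: "0 \<le> pnorm p"
  by (simp add: pnorm_def)

lemma pnorm_power2: "(pnorm p)\<^sup>2 = (norm (fst p))\<^sup>2 + \<bar>snd p\<bar>"
  by (simp add: pnorm_def)

lemma norm_fst_le_pnorm: "norm (fst p) \<le> pnorm p"
  unfolding pnorm_def by (rule real_le_rsqrt) simp

lemma abs_snd_le_pnorm: "\<bar>snd p\<bar> \<le> (pnorm p)\<^sup>2"
  by (simp add: pnorm_power2)

lemma pnorm_le_iff: "0 \<le> c \<Longrightarrow> pnorm p \<le> c \<longleftrightarrow> (norm (fst p))\<^sup>2 + \<bar>snd p\<bar> \<le> c\<^sup>2"
  unfolding pnorm_def by (auto simp: real_sqrt_le_iff' sqrt_le_D real_le_lsqrt)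

lemma pnorm_mono:
  "norm (fst p) \<le> norm (fst q) \<Longrightarrow> \<bar>snd p\<bar> \<le> \<bar>snd q\<bar> \<Longrightarrow> pnorm p \<le> pnorm q"
  unfolding pnorm_def by (intro real_sqrt_le_mono add_mono power_mono) auto

text \<open>After squaring, the time parts simply add, and the cross term of the space parts is at
  most \<open>2 * pnorm p * pnorm q\<close>, because
  \<open>norm (fst p) \<le> pnorm p\<close>.\<close>

lemma pnorm_add: "pnorm (p + q) \<le> pnorm p + pnorm q"
proof -
  have "(norm (fst (p + q)))\<^sup>2 \<le> (norm (fst p) + norm (fst q))\<^sup>2"
    by (intro power_mono) (auto simp: norm_triangle_ineq)
  moreover have "norm (fst p) * norm (fst q) \<le> pnorm p * pnorm q"
    by (intro mult_mono norm_fst_le_pnorm) auto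
  ultimately have "(norm (fst (p + q)))\<^sup>2 + \<bar>snd (p + q)\<bar> \<le> (pnorm p + pnorm q)\<^sup>2"
    using abs_triangle_ineq[of "snd p" "snd q"]
    by (simp add: power2_sum pnorm_power2)
  then show ?thesis
    by (simp add: pnorm_le_iff)
qed

lemma pnorm_minus [simp]: "pnorm (- p) = pnorm p"
  by (simp add: pnorm_def)

lemma pnorm_minus_commute: "pnorm (p - q) = pnorm (q - p)"
  using pnorm_minus[of "p - q"] by simp

lemma pnorm_diff_triangle: "pnorm (p - r) \<le> pnorm (p - q) + pnorm (q - r)"
  using pnorm_add[of "p - q" "q - r"] by simp

lemma pnorm_triangle_diff: "pnorm (p - q) \<le> pnorm p + pnorm q"
  using pnorm_add[of p "- q"] by simp

lemma pnorm_eq_0 [simp]: "pnorm p = 0 \<longleftrightarrow> p = 0"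
  by (auto simp: pnorm_def add_nonneg_eq_0_iff prod_eq_iff)

lemma pnorm_pos [simp]: "0 < pnorm p \<longleftrightarrow> p \<noteq> 0"
  using pnorm_eq_0[of p] pnorm_nonneg[of p] by linarith

lemma pnorm_horizontal [simp]: "pnorm (x, 0) = norm x"
  by (simp add: pnorm_def)

lemma continuous_on_pnorm [continuous_intros]:
  "continuous_on S f \<Longrightarrow> continuous_on S (\<lambda>x. pnorm (f x))"
  unfolding pnorm_def by (intro continuous_intros)

lemma open_pnorm_less: "continuous_on UNIV f \<Longrightarrow> open {x. pnorm (f x) < r}"
  by (intro open_Collect_less continuous_intros)

definition pball :: "'n::finite parabolic \<Rightarrow> real \<Rightarrow> 'n parabolic set" where
  "pball p r = {q. pnorm (q - p) < r}"

lemma mem_pball: "q \<in> pball p r \<longleftrightarrow> pnorm (q - p) < r"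
  by (simp add: pball_def)

lemma open_pball [simp]: "open (pball p r)"
  unfolding pball_def by (intro open_pnorm_less continuous_intros)

lemma pball_borel [measurable]: "pball p r \<in> sets borel"
  by (simp add: borel_open)

lemma pball_empty [simp]: "r \<le> 0 \<Longrightarrow> pball p r = {}"
  unfolding pball_def by (simp add: not_less order_trans[OF _ pnorm_nonneg])

lemma centre_in_pball [simp]: "p \<in> pball p r \<longleftrightarrow> 0 < r"
  by (simp add: mem_pball)

lemma pball_subset: "pnorm (p - q) + r \<le> s \<Longrightarrow> pball p r \<subseteq> pball q s"
  unfolding pball_def
proof (intro subsetI CollectI)
  fix x assume "pnorm (p - q) + r \<le> s" "x \<in> {x. pnorm (x - p) < r}"
  then show "pnorm (x - q) < s"
    using pnorm_diff_triangle[of x q p] by simp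
qed

text \<open>Boundedness is Euclidean here. It is what makes the Lebesgue measure of a piece of a
  tube finite later on.\<close>

lemma bounded_pball: "bounded (pball p r)"
proof -
  have "norm x \<le> norm p + (r + r\<^sup>2)" if "x \<in> pball p r" for x
  proof -
    have x: "pnorm (x - p) \<le> r" using that by (simp add: mem_pball)
    have "norm (x - p) \<le> norm (fst (x - p)) + norm (snd (x - p))"
      by (metis norm_Pair_le prod.collapse)
    also have "\<dots> \<le> r + r\<^sup>2"
      using x norm_fst_le_pnorm[of "x - p"] abs_snd_le_pnorm[of "x - p"]
        power_mono[OF x pnorm_nonneg, of 2] by simp
    finally show ?thesis
      using norm_triangle_sub[of x p] by linarith
  qed
  then show ?thesis
    unfolding bounded_iff by blast
qed

text \<open>The parabolic metric induces the product topology, so parabolic balls serve as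
  neighbourhoods of points in sets that are open in the sense of the type class.\<close>

lemma open_contains_pball:
  assumes "open U" "p \<in> U"
  obtains d where "0 < d" "\<And>r. r \<le> d \<Longrightarrow> pball p r \<subseteq> U"
proof -
  have "eventually (\<lambda>q. q \<in> U) (at p)"
    using assms by (auto simp: eventually_at_topological)
  then obtain d where "d > 0" and d: "\<And>q. q \<noteq> p \<Longrightarrow> pdist q p < d \<Longrightarrow> q \<in> U"
    unfolding eventually_at_within_parabolic by auto
  then show thesis
  proof (intro that[of d] subsetI)
    show "q \<in> U" if "r \<le> d" "q \<in> pball p r" for r q
      using that assms(2) d[of q] by (cases "q = p") (simp_all add: mem_pball pdist_def)
  qed assumption
qed

text \<open>The parabolic dilation. It scales \<open>pnorm\<close> by \<open>\<bar>r\<bar>\<close>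
  and maps planes into themselves, so it yields points of a plane at a prescribed distance in any
  direction, including the time direction.\<close>

definition pdil :: "real \<Rightarrow> 'n::finite parabolic \<Rightarrow> 'n parabolic" where
  "pdil r p = (r *\<^sub>R fst p, r\<^sup>2 * snd p)"

lemma pnorm_pdil [simp]: "pnorm (pdil r p) = \<bar>r\<bar> * pnorm p"
proof -
  have "(norm (fst (pdil r p)))\<^sup>2 + \<bar>snd (pdil r p)\<bar> = r\<^sup>2 * ((norm (fst p))\<^sup>2 + \<bar>snd p\<bar>)"
    by (simp add: pdil_def power_mult_distrib abs_mult algebra_simps)
  then show ?thesis
    by (simp add: pnorm_def real_sqrt_mult)
qed

section \<open>Vitali covering by parabolic balls\<close>

text \<open>Zorn's lemma gives a disjoint subfamily such that each ball of \<open>F\<close> meets a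
  selected ball of at least half its radius, hence lies in the fivefold enlargement of that ball.
  Radius 0 gives an empty ball and pads a finite selection to a sequence.\<close>

theorem parabolic_Vitali_covering:
  fixes F :: "('n::finite parabolic \<times> real) set"
  assumes F: "\<And>p r. (p, r) \<in> F \<Longrightarrow> 0 < r \<and> r \<le> R"
  obtains c :: "nat \<Rightarrow> 'n parabolic" and \<rho> :: "nat \<Rightarrow> real"
  where "\<And>i. (c i, \<rho> i) \<in> F \<or> \<rho> i = 0"
    "disjoint_family (\<lambda>i. pball (c i) (\<rho> i))"
    "\<And>p r. (p, r) \<in> F \<Longrightarrow> pball p r \<subseteq> (\<Union>i. pball (c i) (5 * \<rho> i))"
proof -
  define b where "b = (\<lambda>x :: 'n parabolic \<times> real. pball (fst x) (snd x))"
  \<comment> \<open>Besides disjointness, a ball of \<open>F\<close> that meets the family at all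
    must meet a member of at least half its radius. This condition survives unions of chains, so a
    maximal family exists.\<close>
  define \<D> where "\<D> = {D. D \<subseteq> F \<and> pairwise (\<lambda>x y. disjnt (b x) (b y)) D \<and>
    (\<forall>x\<in>F. (\<exists>y\<in>D. \<not> disjnt (b x) (b y)) \<longrightarrow>
       (\<exists>y\<in>D. \<not> disjnt (b x) (b y) \<and> snd x \<le> 2 * snd y))}"
  have "\<exists>D\<in>\<D>. \<forall>X\<in>\<D>. D \<subseteq> X \<longrightarrow> X = D"
  proof (rule subset_Zorn')
    fix C assume "subset.chain \<D> C"
    then have C: "C \<subseteq> \<D>" "\<And>X Y. X \<in> C \<Longrightarrow> Y \<in> C \<Longrightarrow> X \<subseteq> Y \<or> Y \<subseteq> X"
      by (auto simp: subset_chain_def)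
    have "pairwise (\<lambda>x y. disjnt (b x) (b y)) (\<Union>C)"
    proof (rule pairwiseI)
      fix x y assume "x \<in> \<Union>C" "y \<in> \<Union>C" "x \<noteq> y"
      then obtain X where "X \<in> C" "x \<in> X" "y \<in> X"
        using C(2) by blast
      then show "disjnt (b x) (b y)"
        using C(1) \<open>x \<noteq> y\<close> by (auto simp: \<D>_def pairwise_def)
    qed
    moreover have "\<exists>y\<in>\<Union>C. \<not> disjnt (b x) (b y) \<and> snd x \<le> 2 * snd y"
      if x: "x \<in> F" and ex: "\<exists>y\<in>\<Union>C. \<not> disjnt (b x) (b y)" for x
    proof -
      obtain X where "X \<in> C" "\<exists>y\<in>X. \<not> disjnt (b x) (b y)"
        using ex by blast
      moreover have "X \<in> \<D>" using C(1) \<open>X \<in> C\<close> by auto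
      ultimately show ?thesis
        using x unfolding \<D>_def by blast
    qed
    ultimately show "\<Union>C \<in> \<D>"
      using C(1) unfolding \<D>_def by blast
  qed
  then obtain D where D: "D \<in> \<D>" and max: "\<And>X. X \<in> \<D> \<Longrightarrow> D \<subseteq> X \<Longrightarrow> X = D"
    by blast
  have DF: "D \<subseteq> F" and disj: "pairwise (\<lambda>x y. disjnt (b x) (b y)) D"
    using D by (auto simp: \<D>_def)
  have b_ne: "b x \<noteq> {}" if "x \<in> F" for x
    using F[of "fst x" "snd x"] that centre_in_pball[of "fst x" "snd x"]
    unfolding b_def by (metis empty_iff prod.collapse)
  have meets: "\<exists>y\<in>D. \<not> disjnt (b x) (b y)" if "x \<in> F" for x
  proof (rule ccontr)
    assume x: "\<not> ?thesis"
    \<comment> \<open>If some ball misses all of \<open>D\<close>, then among all such balls one has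
      a radius above half the supremum of their radii. Adding it to \<open>D\<close> preserves both
      conditions, against maximality.\<close>
    define S where "S = {z \<in> F. \<forall>y\<in>D. disjnt (b z) (b y)}"
    have "x \<in> S" using x that by (auto simp: S_def)
    have bdd: "bdd_above (snd ` S)"
      using F by (intro bdd_aboveI[of _ R]) (auto simp: S_def)
    have pos: "0 < snd x" using F[of "fst x" "snd x"] that by simp
    have "snd x \<le> Sup (snd ` S)"
      using \<open>x \<in> S\<close> bdd by (intro cSup_upper) auto
    then have "Sup (snd ` S) / 2 < Sup (snd ` S)"
      using pos by simp
    then obtain z where z: "z \<in> S" "Sup (snd ` S) / 2 < snd z"
      using \<open>x \<in> S\<close> less_cSupD[of "snd ` S" "Sup (snd ` S) / 2"] by blast
    have le: "snd w \<le> 2 * snd z" if "w \<in> S" for w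
      using cSup_upper[OF imageI[OF that, of snd] bdd] z(2) by simp
    have "insert z D \<in> \<D>"
      unfolding \<D>_def
    proof (intro CollectI conjI ballI impI)
      show "insert z D \<subseteq> F" using DF z by (auto simp: S_def)
      show "pairwise (\<lambda>x y. disjnt (b x) (b y)) (insert z D)"
        using disj z by (auto simp: pairwise_insert S_def disjnt_sym)
      fix w assume w: "w \<in> F" "\<exists>y\<in>insert z D. \<not> disjnt (b w) (b y)"
      show "\<exists>y\<in>insert z D. \<not> disjnt (b w) (b y) \<and> snd w \<le> 2 * snd y"
      proof (cases "\<exists>y\<in>D. \<not> disjnt (b w) (b y)")
        case True
        then show ?thesis using D w(1) unfolding \<D>_def by blast
      next
        case False
        then have "w \<in> S" using w by (auto simp: S_def)
        then show ?thesis using le w False by blast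
      qed
    qed
    then have "z \<in> D" using max[of "insert z D"] by blast
    have "z \<in> F" "\<And>y. y \<in> D \<Longrightarrow> disjnt (b z) (b y)"
      using z(1) by (simp_all add: S_def)
    with \<open>z \<in> D\<close> b_ne[of z] show False by (metis disjnt_self_iff_empty)
  qed
  \<comment> \<open>Disjoint open sets are countable in number. The balls are nonempty, so
    disjointness also makes \<open>b\<close> injective on \<open>D\<close>, and \<open>D\<close>
    itself is countable.\<close>
  have "countable (b ` D)"
  proof (rule countable_disjoint_open_subsets)
    show "pairwise disjnt (b ` D)"
      using disj unfolding pairwise_image by (rule pairwise_mono) auto
  qed (auto simp: b_def)
  moreover have inj: "inj_on b D"
  proof (rule inj_onI, rule ccontr)
    fix x y assume xy: "x \<in> D" "y \<in> D" "b x = b y" "x \<noteq> y"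
    then have "disjnt (b x) (b x)" using pairwiseD[OF disj, of x y] by simp
    then show False using b_ne[of x] xy(1) DF by auto
  qed
  ultimately have "countable D"
    using countable_image_inj_on by blast
  define e where "e = to_nat_on D"
  have e: "inj_on e D"
    unfolding e_def by (rule inj_on_to_nat_on) fact
  define x where "x = (\<lambda>i. if i \<in> e ` D then the_inv_into D e i else (0, 0))"
  have x_e: "x (e y) = y" if "y \<in> D" for y
    using that e by (auto simp: x_def the_inv_into_f_f)
  have x_D: "x i \<in> D \<and> e (x i) = i \<or> x i = (0, 0)" for i
    using e by (auto simp: x_def the_inv_into_f_f)
  show thesis
  proof (rule that[of "\<lambda>i. fst (x i)" "\<lambda>i. snd (x i)"])
    show "(fst (x i), snd (x i)) \<in> F \<or> snd (x i) = 0" for i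
      using x_D[of i] DF by auto
    have "disjnt (b (x i)) (b (x j))" if "i \<noteq> j" for i j
    proof (cases "x i \<in> D \<and> e (x i) = i \<and> x j \<in> D \<and> e (x j) = j")
      case True
      then show ?thesis using pairwiseD[OF disj, of "x i" "x j"] that by metis
    next
      case False
      then have "x i = (0, 0) \<or> x j = (0, 0)" using x_D by metis
      then show ?thesis by (auto simp: b_def)
    qed
    then show "disjoint_family (\<lambda>i. pball (fst (x i)) (snd (x i)))"
      by (auto simp: disjoint_family_on_def b_def disjnt_def)
    fix p r assume pr: "(p, r) \<in> F"
    then obtain y where y: "y \<in> D" "\<not> disjnt (b (p, r)) (b y)" "r \<le> 2 * snd y"
      using meets[OF pr] D unfolding \<D>_def by force
    then obtain q where "pnorm (q - p) < r" "pnorm (q - fst y) < snd y"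
      by (auto simp: disjnt_def b_def mem_pball)
    \<comment> \<open>Through the common point \<open>q\<close>, the left side is below
      \<open>2 * r + snd y\<close>, and \<open>r \<le> 2 * snd y\<close>.\<close>
    then have "pnorm (p - fst y) + r \<le> 5 * snd y"
      using pnorm_diff_triangle[of p "fst y" q] y(3) pnorm_minus_commute[of p q] by linarith
    then have "pball p r \<subseteq> pball (fst (x (e y))) (5 * snd (x (e y)))"
      using x_e[OF y(1)] by (simp add: pball_subset)
    then show "pball p r \<subseteq> (\<Union>i. pball (fst (x i)) (5 * snd (x i)))"
      by blast
  qed
qed

section \<open>Planes\<close>

text \<open>A subspace that contains the time axis is a product, since its points can be moved
  freely in time. Time counts twice in the parabolic dimension: the Euclidean dimension
  \<open>m - 1\<close> of a vertical plane leaves \<open>m - 2\<close> for the space factor.\<close>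

lemma planes_cases:
  assumes "V \<in> planes m"
  obtains (horizontal) W where "subspace W" "V = W \<times> {0}" "dim W = m"
  | (vertical) W where "subspace W" "V = W \<times> UNIV" "dim W + 2 = m"
proof (cases "V \<in> horizontal_planes m")
  case True
  then have V: "subspace V" "V \<subseteq> horizontal" "dim V = m"
    by (auto simp: horizontal_planes_def)
  have sub: "subspace (fst ` V)"
    using V(1) by (intro linear_subspace_image linear_fst) 
  have eq: "V = fst ` V \<times> {0}"
    using V(2) by (force simp: horizontal_def)
  then show thesis
    using horizontal[OF sub eq] dim_Times[OF sub subspace_single_0, where 'b = real] V(3) by simp
next
  case False
  then have V: "subspace V" "{0} \<times> UNIV \<subseteq> V" "dim V = m - 1" "m \<ge> 2"
    using assms by (auto simp: planes_def vertical_planes_def)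
  have sub: "subspace (fst ` V)"
    using V(1) by (intro linear_subspace_image linear_fst) 
  have "(x, s) \<in> V" if "(x, t) \<in> V" for x s t
    using subspace_add[OF V(1) that, of "(0, s - t)"] V(2) by auto
  then have eq: "V = fst ` V \<times> UNIV"
    by force
  then show thesis
    using vertical[OF sub eq] dim_Times[OF sub subspace_UNIV, where 'b = real] V(3,4) by simp
qed

section \<open>Orthogonal projections onto subspaces and planes\<close>

lemma orthonormal_basis_expansion:
  fixes W :: "'a::euclidean_space set"
  assumes "subspace W"
  obtains B where "finite B" "B \<subseteq> W" "card B = dim W" "\<And>b. b \<in> B \<Longrightarrow> norm b = 1"
    "\<And>x w. w \<in> W \<Longrightarrow> (x - (\<Sum>b\<in>B. (x \<bullet> b) *\<^sub>R b)) \<bullet> w = 0"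
proof -
  obtain B where B: "B \<subseteq> W" "pairwise orthogonal B" "\<And>x. x \<in> B \<Longrightarrow> norm x = 1"
    "independent B" "card B = dim W" "span B = W"
    using orthonormal_basis_subspace[OF assms] by blast
  have fin: "finite B" using B(4) independent_imp_finite by blast
  have coord: "(x - (\<Sum>c\<in>B. (x \<bullet> c) *\<^sub>R c)) \<bullet> b = 0" if "b \<in> B" for x b
  proof -
    have "(\<Sum>c\<in>B. (x \<bullet> c) *\<^sub>R c) \<bullet> b = (\<Sum>c\<in>B. if c = b then x \<bullet> b else 0)"
      unfolding inner_sum_left
    proof (rule sum.cong)
      show "(x \<bullet> c) *\<^sub>R c \<bullet> b = (if c = b then x \<bullet> b else 0)" if "c \<in> B" for c
        using pairwiseD[OF B(2) that \<open>b \<in> B\<close>] B(3)[OF that]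
        by (cases "c = b") (simp_all add: orthogonal_def dot_square_norm)
    qed simp
    then show ?thesis
      using fin that by (simp add: inner_diff_left)
  qed
  show thesis
  proof (rule that[OF fin B(1,5,3)])
    fix x w assume "w \<in> W"
    then have "orthogonal (x - (\<Sum>b\<in>B. (x \<bullet> b) *\<^sub>R b)) w"
      using B(6) coord by (intro orthogonal_to_span[of w B]) (auto simp: orthogonal_def)
    then show "(x - (\<Sum>b\<in>B. (x \<bullet> b) *\<^sub>R b)) \<bullet> w = 0"
      by (simp add: orthogonal_def)
  qed
qed

lemma subspace_orthogonal_projection:
  fixes W :: "'a::euclidean_space set"
  assumes "subspace W"
  obtains P :: "'a \<Rightarrow> 'a" where "linear P" "\<And>x. P x \<in> W" "\<And>x w. w \<in> W \<Longrightarrow> (x - P x) \<bullet> w = 0"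
    "\<And>w. w \<in> W \<Longrightarrow> P w = w" "\<And>x. norm (P x) \<le> norm x" "\<And>x. norm (x - P x) \<le> norm x"
    "\<And>x. (\<And>w. w \<in> W \<Longrightarrow> x \<bullet> w = 0) \<Longrightarrow> P x = 0"
proof -
  obtain B where B: "finite B" "B \<subseteq> W" "card B = dim W" "\<And>b. b \<in> B \<Longrightarrow> norm b = 1"
    "\<And>x w. w \<in> W \<Longrightarrow> (x - (\<Sum>b\<in>B. (x \<bullet> b) *\<^sub>R b)) \<bullet> w = 0"
    by (rule orthonormal_basis_expansion[OF assms that])
  define P where "P = (\<lambda>x. \<Sum>b\<in>B. (x \<bullet> b) *\<^sub>R b)"
  have lin: "linear P"
    unfolding P_def by (intro linearI) (auto simp: inner_add_left scaleR_add_left sum.distrib scaleR_sum_right)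
  have PW: "P x \<in> W" for x
    unfolding P_def using assms B(2) by (intro subspace_sum subspace_scale) auto
  have orth: "(x - P x) \<bullet> w = 0" if "w \<in> W" for x w
    using B(5)[OF that] by (simp add: P_def)
  have pyth: "(norm x)\<^sup>2 = (norm (P x))\<^sup>2 + (norm (x - P x))\<^sup>2" for x
    using orth[OF PW, of x x] norm_add_Pythagorean[of "P x" "x - P x"]
    by (simp add: orthogonal_def inner_commute)
  have zero: "P x = 0" if "\<And>w. w \<in> W \<Longrightarrow> x \<bullet> w = 0" for x
    using that[OF PW[of x]] orth[OF PW, of x x] by (simp add: inner_diff_left)
  show thesis
  proof (rule that[OF lin PW orth])
    show "P w = w" if "w \<in> W" for w
    proof -
      have "w - P w = 0"
        using orth[OF subspace_diff[OF assms that PW], of w w] unfolding inner_eq_zero_iff .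
      then have "w = P w" by (rule right_minus_eq[THEN iffD1])
      then show ?thesis by (rule sym)
    qed
    show "norm (P x) \<le> norm x" for x
      using pyth[of x] by - (rule power2_le_imp_le; simp)
    show "norm (x - P x) \<le> norm x" for x
      using pyth[of x] by - (rule power2_le_imp_le; simp)
  qed (assumption, fact zero)
qed

lemma subspace_plane: "V \<in> planes m \<Longrightarrow> subspace V"
  by (auto simp: planes_def horizontal_planes_def vertical_planes_def)

lemma pdil_plane: "V \<in> planes m \<Longrightarrow> v \<in> V \<Longrightarrow> pdil r v \<in> V"
  by (erule planes_cases) (auto simp: pdil_def subspace_scale)

text \<open>The Euclidean projection acts on the space coordinate by itself and either deletes or
  keeps the time coordinate. Hence it and its complement shrink both coordinates, and with them the
  parabolic norm.\<close>

lemma plane_projection: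
  fixes V :: "'n::finite parabolic set"
  assumes "V \<in> planes m"
  obtains P where "linear P" "\<And>x. P x \<in> V" "\<And>v. v \<in> V \<Longrightarrow> P v = v"
    "\<And>w. w \<in> orthogonal_comp V \<Longrightarrow> P w = 0" "\<And>x. x - P x \<in> orthogonal_comp V"
    "\<And>x. pnorm (P x) \<le> pnorm x" "\<And>x. pnorm (x - P x) \<le> pnorm x"
  using assms
proof (cases rule: planes_cases)
  case (horizontal W)
  obtain P where P: "linear P" "\<And>x. P x \<in> W" "\<And>x w. w \<in> W \<Longrightarrow> (x - P x) \<bullet> w = 0"
    "\<And>w. w \<in> W \<Longrightarrow> P w = w" "\<And>x. norm (P x) \<le> norm x" "\<And>x. norm (x - P x) \<le> norm x"
    "\<And>x. (\<And>w. w \<in> W \<Longrightarrow> x \<bullet> w = 0) \<Longrightarrow> P x = 0"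
    using subspace_orthogonal_projection[OF horizontal(1)] by blast
  show thesis
  proof (rule that[of "\<lambda>x. (P (fst x), 0)"])
    show "linear (\<lambda>x::(real, 'n) vec \<times> real. (P (fst x), 0::real))"
      by (intro linearI) (auto simp: linear_add[OF P(1)] linear_scale[OF P(1)])
    fix w assume "w \<in> orthogonal_comp V"
    then have "fst w \<bullet> y = 0" if "y \<in> W" for y
      using that horizontal(2)
      by (cases w) (auto simp: orthogonal_comp_def orthogonal_def inner_commute)
    then show "(P (fst w), 0) = 0"
      using P(7)[of "fst w"] by (simp add: zero_prod_def)
  next
    fix x show "x - (P (fst x), 0) \<in> orthogonal_comp V"
      using P(3)[of _ "fst x"] horizontal(2)
      by (cases x) (auto simp: orthogonal_comp_def orthogonal_def inner_commute)
  next
    show "pnorm (P (fst x), 0::real) \<le> pnorm x" "pnorm (x - (P (fst x), 0)) \<le> pnorm x" for x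
      using P(5,6)[of "fst x"] by (intro pnorm_mono; simp)+
  qed (use P(2,4) horizontal(2) in auto)
next
  case (vertical W)
  obtain P where P: "linear P" "\<And>x. P x \<in> W" "\<And>x w. w \<in> W \<Longrightarrow> (x - P x) \<bullet> w = 0"
    "\<And>w. w \<in> W \<Longrightarrow> P w = w" "\<And>x. norm (P x) \<le> norm x" "\<And>x. norm (x - P x) \<le> norm x"
    "\<And>x. (\<And>w. w \<in> W \<Longrightarrow> x \<bullet> w = 0) \<Longrightarrow> P x = 0"
    using subspace_orthogonal_projection[OF vertical(1)] by blast
  have W0: "0 \<in> W" using vertical(1) by (simp add: subspace_0)
  show thesis
  proof (rule that[of "\<lambda>x. (P (fst x), snd x)"])
    show "linear (\<lambda>x::(real, 'n) vec \<times> real. (P (fst x), snd x))"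
      by (intro linearI) (auto simp: linear_add[OF P(1)] linear_scale[OF P(1)])
    fix w assume "w \<in> orthogonal_comp V"
    then have w: "fst w \<bullet> y + snd w * t = 0" if "y \<in> W" for y t
      using that vertical(2)
      by (cases w) (auto simp: orthogonal_comp_def orthogonal_def inner_commute mult.commute)
    have "P (fst w) = 0"
      using w[of _ 0] by (auto intro: P(7))
    moreover have "snd w = 0"
      using w[OF W0, of 1] by simp
    ultimately show "(P (fst w), snd w) = 0" by (simp add: zero_prod_def)
  next
    fix x show "x - (P (fst x), snd x) \<in> orthogonal_comp V"
      using P(3)[of _ "fst x"] vertical(2)
      by (cases x) (auto simp: orthogonal_comp_def orthogonal_def inner_commute)
  next
    show "pnorm (P (fst x), snd x) \<le> pnorm x" "pnorm (x - (P (fst x), snd x)) \<le> pnorm x" for x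
      using P(5,6)[of "fst x"] by (intro pnorm_mono; simp)+
  qed (use P(2,4) vertical(2) in auto)
qed

section \<open>Coverings of balls in a plane by grids\<close>

text \<open>In orthonormal coordinates, a grid of step \<open>R / k\<close> has
  \<open>2 * k + 1 \<le> 3 * k\<close> values per coordinate. Rounding costs at most
  \<open>R / k\<close> in each of them.\<close>

lemma subspace_grid_cover:
  fixes W :: "'a::euclidean_space set"
  assumes "subspace W"
  shows "\<exists>C::real>0. \<forall>k\<ge>1. \<forall>R>0.
     \<exists>F. finite F \<and> F \<subseteq> W \<and> card F \<le> (3 * k) ^ dim W \<and>
       (\<forall>y\<in>W. norm y < R \<longrightarrow> (\<exists>a\<in>F. norm (y - a) \<le> C * R / real k))"
proof -
  obtain B where fin: "finite B" and B: "B \<subseteq> W" "card B = dim W" "\<And>x. x \<in> B \<Longrightarrow> norm x = 1"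
    "\<And>x w. w \<in> W \<Longrightarrow> (x - (\<Sum>b\<in>B. (x \<bullet> b) *\<^sub>R b)) \<bullet> w = 0"
    by (rule orthonormal_basis_expansion[OF assms that])
  have expand: "(\<Sum>b\<in>B. (y \<bullet> b) *\<^sub>R b) = y" if "y \<in> W" for y
  proof -
    have "y - (\<Sum>b\<in>B. (y \<bullet> b) *\<^sub>R b) \<in> W"
      using assms that B(1) by (intro subspace_diff subspace_sum subspace_scale) auto
    from B(4)[OF this, of y] show ?thesis by simp
  qed
  show ?thesis
  \<comment> \<open>The summand 1 keeps the constant positive when \<open>dim W = 0\<close>.\<close>
  proof (intro exI[of _ "real (dim W) + 1"] conjI allI impI)
    fix k :: nat and R :: real assume k: "k \<ge> 1" and R: "R > 0"
    define Z where "Z = (PiE B (\<lambda>_. {- int k..int k}))"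
    define a where "a = (\<lambda>z. \<Sum>b\<in>B. (R * of_int (z b) / real k) *\<^sub>R b)"
    have "finite Z" using fin by (auto simp: Z_def intro: finite_PiE)
    have "card Z = (2 * k + 1) ^ dim W"
      using fin B(2) by (simp add: Z_def card_PiE nat_add_distrib nat_mult_distrib)
    also have "\<dots> \<le> (3 * k) ^ dim W"
      using k by (intro power_mono) auto
    finally have "card (a ` Z) \<le> (3 * k) ^ dim W"
      using card_image_le[OF \<open>finite Z\<close>, of a] by linarith
    moreover have "a ` Z \<subseteq> W"
      using B(1) assms by (auto simp: a_def intro!: subspace_sum subspace_scale)
    moreover have "\<exists>x\<in>a ` Z. norm (y - x) \<le> (real (dim W) + 1) * R / real k"
      if y: "y \<in> W" "norm y < R" for y
    proof -
      define z where "z = restrict (\<lambda>b. \<lfloor>real k * (y \<bullet> b) / R\<rfloor>) B"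
      have bound: "\<bar>real k * (y \<bullet> b) / R\<bar> \<le> real k" if "b \<in> B" for b
      proof -
        have "\<bar>y \<bullet> b\<bar> \<le> R"
          using Cauchy_Schwarz_ineq2[of y b] B(3)[OF that] y by simp
        then have "real k * \<bar>y \<bullet> b\<bar> \<le> real k * R"
          by (intro mult_left_mono) auto
        then show ?thesis
          using R by (simp add: abs_mult divide_simps)
      qed
      have "z \<in> Z"
        unfolding Z_def z_def
      proof (intro restrict_PiE_iff[THEN iffD2] ballI)
        fix b assume "b \<in> B"
        from bound[OF this] have "- real k \<le> real k * (y \<bullet> b) / R" "real k * (y \<bullet> b) / R \<le> real k"
          unfolding abs_le_iff by linarith+
        then show "\<lfloor>real k * (y \<bullet> b) / R\<rfloor> \<in> {- int k..int k}"
          by (simp add: le_floor_iff floor_le_iff)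
      qed
      have "norm (y - a z) = norm (\<Sum>b\<in>B. (y \<bullet> b - R * of_int (z b) / real k) *\<^sub>R b)"
        using expand[OF y(1)] by (simp add: a_def scaleR_diff_left sum_subtractf)
      also have "\<dots> \<le> (\<Sum>b\<in>B. R / real k)"
      proof (rule sum_norm_le)
        fix b assume b: "b \<in> B"
        have "\<bar>real k * (y \<bullet> b) / R - of_int (z b)\<bar> \<le> 1"
          using b by (simp add: z_def) linarith
        then have "R / real k * \<bar>real k * (y \<bullet> b) / R - of_int (z b)\<bar> \<le> R / real k * 1"
          using R by (intro mult_left_mono) auto
        also have "R / real k * \<bar>real k * (y \<bullet> b) / R - of_int (z b)\<bar> =
            \<bar>R / real k * (real k * (y \<bullet> b) / R - of_int (z b))\<bar>"
          using R by (simp add: abs_mult)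
        also have "R / real k * (real k * (y \<bullet> b) / R - of_int (z b)) =
            y \<bullet> b - R * of_int (z b) / real k"
          using R k by (simp add: field_simps)
        finally show "norm ((y \<bullet> b - R * of_int (z b) / real k) *\<^sub>R b) \<le> R / real k"
          using B(3)[OF b] by simp
      qed
      also have "\<dots> \<le> (real (dim W) + 1) * R / real k"
        using R B(2) by (simp add: divide_right_mono)
      finally show ?thesis using \<open>z \<in> Z\<close> by blast
    qed
    ultimately show "\<exists>F. finite F \<and> F \<subseteq> W \<and> card F \<le> (3 * k) ^ dim W \<and>
       (\<forall>y\<in>W. norm y < R \<longrightarrow> (\<exists>a\<in>F. norm (y - a) \<le> (real (dim W) + 1) * R / real k))"
      using \<open>finite Z\<close> by (intro exI[of _ "a ` Z"]) auto
  qed (simp add: add_nonneg_pos)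
qed

lemma interval_grid_cover:
  fixes R :: real
  assumes "k \<ge> 1" "R > 0"
  shows "\<exists>F. finite F \<and> card F \<le> 3 * k \<and> (\<forall>t. \<bar>t\<bar> < R \<longrightarrow> (\<exists>a\<in>F. \<bar>t - a\<bar> \<le> R / real k))"
proof (intro exI conjI allI impI)
  let ?a = "\<lambda>j::int. R * of_int j / real k"
  show "finite (?a ` {- int k..int k})" by simp
  show "card (?a ` {- int k..int k}) \<le> 3 * k"
    using card_image_le[of "{- int k..int k}" ?a] assms by simp
  fix t assume t: "\<bar>t\<bar> < R"
  define j where "j = \<lfloor>real k * t / R\<rfloor>"
  have "real k * \<bar>t\<bar> \<le> real k * R"
    using t by (intro mult_left_mono) auto
  then have "\<bar>real k * t / R\<bar> \<le> real k"
    using assms by (simp add: abs_mult divide_simps)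
  then have "- real k \<le> real k * t / R" "real k * t / R \<le> real k"
    unfolding abs_le_iff by linarith+
  then have "j \<in> {- int k..int k}"
    by (simp add: j_def le_floor_iff floor_le_iff)
  moreover have "\<bar>t - ?a j\<bar> \<le> R / real k"
  proof -
    have "\<bar>real k * t / R - of_int j\<bar> \<le> 1"
      by (simp add: j_def) linarith
    then have "R / real k * \<bar>real k * t / R - of_int j\<bar> \<le> R / real k * 1"
      using assms by (intro mult_left_mono) auto
    also have "R / real k * \<bar>real k * t / R - of_int j\<bar> =
        \<bar>R / real k * (real k * t / R - of_int j)\<bar>"
      using assms by (simp add: abs_mult)
    also have "R / real k * (real k * t / R - of_int j) = t - ?a j"
      using assms by (simp add: field_simps)
    finally show ?thesis by simp
  qed
  ultimately show "\<exists>a\<in>?a ` {- int k..int k}. \<bar>t - a\<bar> \<le> R / real k"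
    by blast
qed

text \<open>The exponent \<open>m\<close> is the parabolic dimension: \<open>k\<^sup>2\<close> rather than \<open>k\<close> subintervals are needed in
  the time direction.\<close>

lemma plane_grid_cover:
  assumes "V \<in> planes m"
  shows "\<exists>C::real>0. \<forall>k\<ge>1. \<forall>R>0.
     \<exists>F. finite F \<and> F \<subseteq> V \<and> card F \<le> (3 * k) ^ m \<and>
       (\<forall>v\<in>V. pnorm v < R \<longrightarrow> (\<exists>a\<in>F. pnorm (v - a) < C * R / real k))"
  using assms
proof (cases rule: planes_cases)
  case (horizontal W)
  obtain C :: real where C: "C > 0" "\<forall>k\<ge>1. \<forall>R>0.
     \<exists>F. finite F \<and> F \<subseteq> W \<and> card F \<le> (3 * k) ^ dim W \<and>
       (\<forall>y\<in>W. norm y < R \<longrightarrow> (\<exists>a\<in>F. norm (y - a) \<le> C * R / real k))"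
    using subspace_grid_cover[OF horizontal(1)] by metis
  show ?thesis
  \<comment> \<open>The increase of the constant makes the distance bound strict, so that the grid
    points are centres of open balls.\<close>
  proof (intro exI[of _ "C + 1"] conjI allI impI)
    fix k :: nat and R :: real assume kR: "k \<ge> 1" "R > 0"
    then obtain F where F: "finite F" "F \<subseteq> W" "card F \<le> (3 * k) ^ m"
       "\<forall>y\<in>W. norm y < R \<longrightarrow> (\<exists>a\<in>F. norm (y - a) \<le> C * R / real k)"
      using C(2) kR unfolding horizontal(3) by metis
    have lt: "C * R / real k < (C + 1) * R / real k"
      using kR by (intro divide_strict_right_mono mult_strict_right_mono) auto
    have "\<exists>a\<in>(\<lambda>a. (a, 0)) ` F. pnorm (v - a) < (C + 1) * R / real k"
      if v: "v \<in> V" "pnorm v < R" for v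
    proof -
      obtain y where y: "v = (y, 0)" "y \<in> W" "norm y < R"
        using v horizontal(2) by (cases v) auto
      from F(4) y(2,3) obtain a where "a \<in> F" "norm (y - a) \<le> C * R / real k" by blast
      then show ?thesis
        using y(1) lt by (auto intro: le_less_trans)
    qed
    moreover have "(\<lambda>a. (a, 0)) ` F \<subseteq> V" using F(2) horizontal(2) by auto
    moreover have "card ((\<lambda>a. (a, 0::real)) ` F) \<le> (3 * k) ^ m"
      using F(3) card_image_le[OF F(1), of "\<lambda>a. (a, 0::real)"] by linarith
    ultimately show "\<exists>F. finite F \<and> F \<subseteq> V \<and> card F \<le> (3 * k) ^ m \<and>
       (\<forall>v\<in>V. pnorm v < R \<longrightarrow> (\<exists>a\<in>F. pnorm (v - a) < (C + 1) * R / real k))"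
      using F(1) by (intro exI[of _ "(\<lambda>a. (a, 0)) ` F"]) auto
  qed (use C(1) in simp)
next
  case (vertical W)
  obtain C :: real where C: "C > 0" "\<forall>k\<ge>1. \<forall>R>0.
     \<exists>F. finite F \<and> F \<subseteq> W \<and> card F \<le> (3 * k) ^ dim W \<and>
       (\<forall>y\<in>W. norm y < R \<longrightarrow> (\<exists>a\<in>F. norm (y - a) \<le> C * R / real k))"
    using subspace_grid_cover[OF vertical(1)] by metis
  show ?thesis
  \<comment> \<open>One unit pays for the time error, the other makes the bound strict.\<close>
  proof (intro exI[of _ "C + 2"] conjI allI impI)
    fix k :: nat and R :: real assume kR: "k \<ge> 1" "R > 0"
    then obtain F where F: "finite F" "F \<subseteq> W" "card F \<le> (3 * k) ^ dim W"
       "\<forall>y\<in>W. norm y < R \<longrightarrow> (\<exists>a\<in>F. norm (y - a) \<le> C * R / real k)"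
      using C(2) kR by metis
    \<comment> \<open>A time error of \<open>R\<^sup>2 / k\<^sup>2\<close> has parabolic size
      \<open>R / k\<close>, the same as the error in space.\<close>
    obtain T where T: "finite T" "card T \<le> 3 * k\<^sup>2"
      "\<And>t. \<bar>t\<bar> < R\<^sup>2 \<Longrightarrow> \<exists>a\<in>T. \<bar>t - a\<bar> \<le> R\<^sup>2 / real (k\<^sup>2)"
      using interval_grid_cover[of "k\<^sup>2" "R\<^sup>2"] kR by auto
    have lt: "C * R / real k + R / real k < (C + 2) * R / real k"
      using kR by (simp add: add_divide_distrib[symmetric] distrib_right divide_strict_right_mono)
    have "\<exists>a\<in>F \<times> T. pnorm (v - a) < (C + 2) * R / real k"
      if "v \<in> V" "pnorm v < R" for v
    proof -
      have "norm (fst v) < R" using norm_fst_le_pnorm[of v] that by simp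
      moreover have "\<bar>snd v\<bar> < R\<^sup>2"
        using abs_snd_le_pnorm[of v] that power_strict_mono[of "pnorm v" R 2] by simp
      moreover have "fst v \<in> W" using that vertical(2) by auto
      ultimately obtain a s where as: "a \<in> F" "norm (fst v - a) \<le> C * R / real k"
        "s \<in> T" "\<bar>snd v - s\<bar> \<le> R\<^sup>2 / real (k\<^sup>2)"
        using F(4) T(3) by metis
      have "0 \<le> R / real k" "0 \<le> C * R / real k" using kR C(1) by auto
      have "(norm (fst v - a))\<^sup>2 + \<bar>snd v - s\<bar> \<le> (C * R / real k)\<^sup>2 + (R / real k)\<^sup>2"
        using as power_mono[OF as(2), of 2] by (simp add: power_divide)
      also have "\<dots> \<le> (C * R / real k + R / real k)\<^sup>2"
        using kR C(1) by (simp add: power2_sum)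
      finally have "pnorm (v - (a, s)) \<le> C * R / real k + R / real k"
        using kR C(1) by (subst pnorm_le_iff) auto
      then show ?thesis using as lt by (intro bexI[of _ "(a, s)"]) auto
    qed
    moreover have "F \<times> T \<subseteq> V" using F(2) vertical(2) by auto
    moreover have "card (F \<times> T) \<le> (3 * k) ^ m"
    proof -
      have "card (F \<times> T) \<le> (3 * k) ^ dim W * (3 * k\<^sup>2)"
        unfolding card_cartesian_product using F(3) T(2) by (intro mult_mono) auto
      also have "\<dots> \<le> (3 * k) ^ dim W * (3 * k) ^ 2"
        by (intro mult_left_mono) (auto simp: power_mult_distrib)
      also have "\<dots> = (3 * k) ^ m"
        unfolding vertical(3)[symmetric] by (rule power_add[symmetric])
      finally show ?thesis .
    qed
    ultimately show "\<exists>F. finite F \<and> F \<subseteq> V \<and> card F \<le> (3 * k) ^ m \<and>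
       (\<forall>v\<in>V. pnorm v < R \<longrightarrow> (\<exists>a\<in>F. pnorm (v - a) < (C + 2) * R / real k))"
      using F(1) T(1) by (intro exI[of _ "F \<times> T"]) auto
  qed (use C(1) in simp)
qed

section \<open>Sets of Hausdorff measure zero\<close>

lemma hausdorff_0_iff: "hausdorff m A = 0 \<longleftrightarrow> (\<forall>\<delta>>0. hausdorff_pre m \<delta> A = 0)"
  unfolding hausdorff_eq_SUP bot_ennreal[symmetric] SUP_bot_conv by auto

text \<open>Only null sets of the Hausdorff measure matter in the proof, so this criterion by covers
  and \<open>hausdorff_0E\<close> replace any work with its values.\<close>

lemma hausdorff_0I:
  assumes "\<And>\<delta> e. 0 < \<delta> \<Longrightarrow> 0 < e \<Longrightarrow>
    \<exists>E. A \<subseteq> (\<Union>i. E i) \<and> (\<forall>i. pdiam (E i) < ennreal \<delta>) \<and> (\<Sum>i. pdiam (E i) ^ m) \<le> ennreal e"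
  shows "hausdorff m A = 0"
  unfolding hausdorff_0_iff
proof (intro allI impI)
  fix \<delta> :: real assume "0 < \<delta>"
  have "hausdorff_pre m \<delta> A \<le> 0"
  proof (rule ennreal_le_epsilon)
    fix e :: real assume "0 < e"
    from assms[OF \<open>0 < \<delta>\<close> this] obtain E where E: "A \<subseteq> (\<Union>i. E i)"
      "\<forall>i. pdiam (E i) < ennreal \<delta>" "(\<Sum>i. pdiam (E i) ^ m) \<le> ennreal e"
      by blast
    then show "hausdorff_pre m \<delta> A \<le> 0 + ennreal e"
      unfolding hausdorff_pre_def by (intro INF_lower2[of E]) auto
  qed
  then show "hausdorff_pre m \<delta> A = 0" by simp
qed

lemma hausdorff_0E:
  assumes "hausdorff m A = 0" "0 < \<delta>" "0 < e"
  obtains E where "A \<subseteq> (\<Union>i. E i)" "\<And>i. pdiam (E i) < ennreal \<delta>"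
    "(\<Sum>i. pdiam (E i) ^ m) < ennreal e"
proof -
  have "hausdorff_pre m \<delta> A < ennreal e"
    using assms by (simp add: hausdorff_0_iff)
  then show thesis
    unfolding hausdorff_pre_def INF_less_iff using that by blast
qed

lemma hausdorff_0_mono: "hausdorff m B = 0 \<Longrightarrow> A \<subseteq> B \<Longrightarrow> hausdorff m A = 0"
proof (rule hausdorff_0I)
  assume B: "hausdorff m B = 0" "A \<subseteq> B"
  fix \<delta> e :: real assume "0 < \<delta>" "0 < e"
  obtain E where "B \<subseteq> (\<Union>i. E i)" "\<And>i. pdiam (E i) < ennreal \<delta>"
    "(\<Sum>i. pdiam (E i) ^ m) < ennreal e"
    by (rule hausdorff_0E[OF B(1) \<open>0 < \<delta>\<close> \<open>0 < e\<close> that])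
  then show "\<exists>E. A \<subseteq> (\<Union>i. E i) \<and> (\<forall>i. pdiam (E i) < ennreal \<delta>) \<and>
      (\<Sum>i. pdiam (E i) ^ m) \<le> ennreal e"
    using B(2) by (intro exI[of _ E]) (auto intro: less_imp_le)
qed

text \<open>The cover of the set with index \<open>i\<close> gets the share
  \<open>e / 2 ^ Suc i\<close>, and the shares add up to \<open>e\<close>. A pairing function turns
  the double sequence of covering sets into a single one.\<close>

lemma hausdorff_0_UN:
  fixes A :: "nat \<Rightarrow> 'n::finite parabolic set"
  assumes "\<And>i. hausdorff m (A i) = 0"
  shows "hausdorff m (\<Union>i. A i) = 0"
proof (rule hausdorff_0I)
  fix \<delta> e :: real assume "0 < \<delta>" "0 < e"
  have "\<exists>E. A i \<subseteq> (\<Union>j. E j) \<and> (\<forall>j. pdiam (E j) < ennreal \<delta>) \<and>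
      (\<Sum>j. pdiam (E j) ^ m) < ennreal (e * (1 / 2) ^ Suc i)" for i
    by (rule hausdorff_0E[OF assms \<open>0 < \<delta>\<close>, of "e * (1 / 2) ^ Suc i"]) (use \<open>0 < e\<close> in auto)
  then obtain E where E: "\<And>i. A i \<subseteq> (\<Union>j. E i j)" "\<And>i j. pdiam (E i j) < ennreal \<delta>"
      "\<And>i. (\<Sum>j. pdiam (E i j) ^ m) < ennreal (e * (1 / 2) ^ Suc i)"
    by metis
  define F where "F = (\<lambda>k. E (fst (prod_decode k)) (snd (prod_decode k)))"
  have "(\<Union>i. A i) \<subseteq> (\<Union>k. F k)"
  proof
    fix x assume "x \<in> (\<Union>i. A i)"
    then obtain i j where "x \<in> E i j" using E(1) by blast
    then have "x \<in> F (prod_encode (i, j))" by (simp add: F_def)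
    then show "x \<in> (\<Union>k. F k)" by blast
  qed
  moreover have "\<forall>k. pdiam (F k) < ennreal \<delta>"
    using E(2) by (simp add: F_def)
  moreover have "(\<Sum>k. pdiam (F k) ^ m) \<le> ennreal e"
  proof -
    have "(\<Sum>k. pdiam (F k) ^ m) = (\<Sum>i. \<Sum>j. pdiam (E i j) ^ m)"
      using suminf_ennreal_2dimen[of "\<lambda>i. \<Sum>j. pdiam (E i j) ^ m" "\<lambda>(i, j). pdiam (E i j) ^ m"]
      by (simp add: F_def case_prod_beta)
    also have "\<dots> \<le> (\<Sum>i. ennreal (e * (1 / 2) ^ Suc i))"
      using E(3) by (intro suminf_le) (auto intro: less_imp_le)
    also have "\<dots> = ennreal e"
      using sums_mult[OF power_half_series, of e] \<open>0 < e\<close> by (intro suminf_ennreal_eq) auto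
    finally show ?thesis .
  qed
  ultimately show "\<exists>E. (\<Union>i. A i) \<subseteq> (\<Union>i. E i) \<and> (\<forall>i. pdiam (E i) < ennreal \<delta>) \<and>
      (\<Sum>i. pdiam (E i) ^ m) \<le> ennreal e"
    by blast
qed

lemma hausdorff_0_Un:
  assumes "hausdorff m A = 0" "hausdorff m B = 0"
  shows "hausdorff m (A \<union> B) = 0"
proof -
  have "hausdorff m (\<Union>i::nat. if i = 0 then A else B) = 0"
    using assms by (intro hausdorff_0_UN) simp
  moreover have "A \<union> B \<subseteq> (\<Union>i::nat. if i = 0 then A else B)"
    by (auto split: if_splits intro: exI[of _ "0::nat"] exI[of _ "1::nat"])
  ultimately show ?thesis by (rule hausdorff_0_mono)
qed

lemma pdiam_le: "(\<And>p q. p \<in> E \<Longrightarrow> q \<in> E \<Longrightarrow> pnorm (p - q) \<le> d) \<Longrightarrow> pdiam E \<le> ennreal d"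
  unfolding pdiam_def pdist_def by (intro SUP_least ennreal_leI)

lemma pdiam_pball_le: "pdiam (pball p r) \<le> ennreal (2 * r)"
proof (rule pdiam_le)
  fix q q' assume "q \<in> pball p r" "q' \<in> pball p r"
  then show "pnorm (q - q') \<le> 2 * r"
    using pnorm_diff_triangle[of q q' p] pnorm_minus_commute[of p q'] by (simp add: mem_pball)
qed

lemma pdiam_image_le:
  assumes "\<And>p q. p \<in> E \<Longrightarrow> q \<in> E \<Longrightarrow> pnorm (f p - f q) \<le> pnorm (p - q)"
  shows "pdiam (f ` E) \<le> pdiam E"
proof -
  have "ennreal (pdist (f p) (f q)) \<le> pdiam E" if "p \<in> E" "q \<in> E" for p q
  proof -
    have "ennreal (pdist (f p) (f q)) \<le> ennreal (pdist p q)"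
      using assms[OF that] by (simp add: pdist_def ennreal_leI)
    also have "\<dots> \<le> pdiam E"
      unfolding pdiam_def using that by (intro SUP_upper2[of p] SUP_upper2[of q]) auto
    finally show ?thesis .
  qed
  then show ?thesis
    unfolding pdiam_def[of "f ` E"] by (auto intro!: SUP_least)
qed

text \<open>Contractions do not enlarge the sets of a cover. This transfers null sets from a graph
  to its plane by the projection.\<close>

lemma hausdorff_0_image:
  assumes "hausdorff m A = 0" and f: "\<And>p q. pnorm (f p - f q) \<le> pnorm (p - q)"
  shows "hausdorff m (f ` A) = 0"
proof (rule hausdorff_0I)
  fix \<delta> e :: real assume "0 < \<delta>" "0 < e"
  obtain E where E: "A \<subseteq> (\<Union>i. E i)" "\<And>i. pdiam (E i) < ennreal \<delta>"
    "(\<Sum>i. pdiam (E i) ^ m) < ennreal e"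
    by (rule hausdorff_0E[OF assms(1) \<open>0 < \<delta>\<close> \<open>0 < e\<close> that])
  have le: "pdiam (f ` E i) \<le> pdiam (E i)" for i
    by (rule pdiam_image_le) (rule f)
  have "f ` A \<subseteq> (\<Union>i. f ` E i)" using E(1) by blast
  moreover have "\<forall>i. pdiam (f ` E i) < ennreal \<delta>"
    using le E(2) by (blast intro: le_less_trans)
  moreover have "(\<Sum>i. pdiam (f ` E i) ^ m) \<le> (\<Sum>i. pdiam (E i) ^ m)"
    using le by (intro suminf_le power_mono) auto
  ultimately show "\<exists>E. f ` A \<subseteq> (\<Union>i. E i) \<and> (\<forall>i. pdiam (E i) < ennreal \<delta>) \<and>
      (\<Sum>i. pdiam (E i) ^ m) \<le> ennreal e"
    using E(3) by (intro exI[of _ "\<lambda>i. f ` E i"]) auto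
qed

section \<open>Lebesgue measure on a plane and porosity\<close>

text \<open>A substitute for the Hausdorff measure on \<open>V\<close>. No scaling law is assumed:
  the growth of the measure of balls follows from translation invariance and grid coverings.\<close>

locale plane_measure =
  fixes V :: "'n::finite parabolic set" and m :: nat and M :: "'n parabolic measure"
  assumes V: "V \<in> planes m"
    and sets_M [simp, measurable_cong]: "sets M = sets borel"
    and translate: "\<And>p r. p \<in> V \<Longrightarrow> emeasure M (pball p r) = emeasure M (pball 0 r)"
    and pos: "\<And>r. 0 < r \<Longrightarrow> 0 < emeasure M (pball 0 r)"
    and finite_pball: "\<And>p r. emeasure M (pball p r) < \<infinity>"
    and off_V: "emeasure M (- V) = 0"

text \<open>\<open>M\<close> is the image under \<open>P\<close> of Lebesgue measure on the tube
  \<open>T\<close> of radius 1. The part of the tube over a ball is open, which gives positivity,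
  and bounded, which gives finiteness.\<close>

lemma exists_plane_measure:
  fixes V :: "'n::finite parabolic set"
  assumes "V \<in> planes m"
  shows "\<exists>M. plane_measure V m M"
proof -
  obtain P where P: "linear P" "\<And>x. P x \<in> V" "\<And>v. v \<in> V \<Longrightarrow> P v = v"
    "\<And>w. w \<in> orthogonal_comp V \<Longrightarrow> P w = 0" "\<And>x. x - P x \<in> orthogonal_comp V"
    "\<And>x. pnorm (P x) \<le> pnorm x" "\<And>x. pnorm (x - P x) \<le> pnorm x"
    using plane_projection[OF assms] by blast
  have contP: "continuous_on UNIV P"
    using P(1) by (rule linear_continuous_on_compose[OF continuous_on_id, simplified])
  have [measurable]: "P \<in> borel_measurable borel"
    using contP by (rule borel_measurable_continuous_onI)
  define T where "T = {x. pnorm (x - P x) < 1}"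
  have openT: "open T"
    unfolding T_def by (intro open_pnorm_less continuous_intros contP)
  then have [measurable]: "T \<in> sets borel" by simp
  define M where "M = distr (density lborel (indicator T)) borel P"
  have em: "emeasure M S = emeasure lborel (T \<inter> P -` S)" if S: "S \<in> sets borel" for S
  proof -
    have "P -` S \<in> sets borel" using measurable_sets[OF \<open>P \<in> _\<close> S] by simp
    then show ?thesis
      using S by (simp add: M_def emeasure_distr emeasure_restricted)
  qed
  have closedV: "closed V"
    using assms by (intro closed_subspace subspace_plane)
  show ?thesis
  proof (intro exI plane_measure.intro)
    show "sets M = sets borel" by (simp add: M_def)
    fix p :: "'n parabolic" and r :: real
    show "emeasure M (pball p r) = emeasure M (pball 0 r)" if "p \<in> V"
    proof -
      \<comment> \<open>As \<open>P p = p\<close>, translation by \<open>p\<close> preserves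
        \<open>x - P x\<close>, hence the tube, and shifts \<open>P x\<close> by
        \<open>p\<close>.\<close>
      have vim: "(+) p -` (T \<inter> P -` pball p r) = T \<inter> P -` pball 0 r"
        by (rule set_eqI) (simp add: T_def mem_pball linear_add[OF P(1)] P(3)[OF that])
      have meas: "T \<inter> P -` pball p r \<in> sets borel"
        using measurable_sets[OF \<open>P \<in> borel_measurable borel\<close> pball_borel, of p r] by simp
      have "emeasure M (pball p r) = emeasure (distr lborel borel ((+) p)) (T \<inter> P -` pball p r)"
        by (simp add: em lborel_distr_plus)
      also have "\<dots> = emeasure lborel ((+) p -` (T \<inter> P -` pball p r))"
        using meas by (simp add: emeasure_distr)
      finally show ?thesis unfolding vim by (simp add: em)
    qed
    show "0 < emeasure M (pball 0 r)" if "0 < r"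
    proof -
      have "open (T \<inter> P -` pball 0 r)"
        using openT contP by (intro open_Int open_vimage) auto
      moreover have "0 \<in> T \<inter> P -` pball 0 r"
        using that linear_0[OF P(1)] by (simp add: T_def)
      ultimately have "\<not> negligible (T \<inter> P -` pball 0 r)" "T \<inter> P -` pball 0 r \<in> sets lborel"
        using open_not_negligible[of "T \<inter> P -` pball 0 r"] by auto
      then have "emeasure lborel (T \<inter> P -` pball 0 r) \<noteq> 0"
        unfolding negligible_iff_null_sets by (auto dest: null_setsI intro: null_sets_completionI)
      then show ?thesis
        by (simp add: em zero_less_iff_neq_zero)
    qed
    show "emeasure M (pball p r) < \<infinity>"
    proof -
      have "T \<inter> P -` pball p r \<subseteq> pball p (r + 1)"
      proof
        fix x assume x: "x \<in> T \<inter> P -` pball p r"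
        then show "x \<in> pball p (r + 1)"
          using pnorm_diff_triangle[of x p "P x"] by (simp add: T_def mem_pball)
      qed
      then have "bounded (T \<inter> P -` pball p r)"
        by (rule bounded_subset[OF bounded_pball])
      then show ?thesis
        using emeasure_bounded_finite by (simp add: em)
    qed
    have "P -` (- V) = {}" using P(2) by blast
    then show "emeasure M (- V) = 0"
      using closedV by (subst em) auto
  qed fact
qed

context plane_measure
begin

lemma m_pos: "0 < m"
  using V by (auto simp: planes_def horizontal_planes_def vertical_planes_def)

lemma closed_V: "closed V"
  using V by (intro closed_subspace subspace_plane)

lemma emeasure_pball: "p \<in> V \<Longrightarrow> emeasure M (pball p r) = ennreal (measure M (pball 0 r))"
  using finite_pball[of 0 r] by (subst translate) (auto simp: emeasure_eq_ennreal_measure)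

lemma measure_pball_mono: "r \<le> s \<Longrightarrow> measure M (pball 0 r) \<le> measure M (pball 0 s)"
  unfolding measure_def using finite_pball[of 0 s]
  by (intro enn2real_mono emeasure_mono pball_subset) auto

lemma measure_pball_pos: "0 < r \<Longrightarrow> 0 < measure M (pball 0 r)"
  using pos[of r] finite_pball[of 0 r] by (simp add: measure_def enn2real_positive_iff)

section \<open>Doubling and lower bounds for the measure of balls\<close>

text \<open>Up to the null set \<open>- V\<close>, the large ball is covered by small balls centred
  in \<open>V\<close>, which all have the same measure. Doubling and the lower bound come from two
  choices of \<open>k\<close>.\<close>

lemma grid_bound:
  obtains C where "C > 0" "\<And>k R. k \<ge> 1 \<Longrightarrow> R > 0 \<Longrightarrow>
    measure M (pball 0 R) \<le> real ((3 * k) ^ m) * measure M (pball 0 (C * R / real k))"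
proof -
  obtain C :: real where "C > 0" and C: "\<forall>k\<ge>1. \<forall>R>0.
     \<exists>F. finite F \<and> F \<subseteq> V \<and> card F \<le> (3 * k) ^ m \<and>
       (\<forall>v\<in>V. pnorm v < R \<longrightarrow> (\<exists>a\<in>F. pnorm (v - a) < C * R / real k))"
    using plane_grid_cover[OF V] by metis
  show thesis
  proof (rule that[OF \<open>C > 0\<close>])
    fix k :: nat and R :: real assume "k \<ge> 1" "R > 0"
    then obtain F where F: "finite F" "F \<subseteq> V" "card F \<le> (3 * k) ^ m"
       "\<forall>v\<in>V. pnorm v < R \<longrightarrow> (\<exists>a\<in>F. pnorm (v - a) < C * R / real k)"
      using C by metis
    let ?b = "measure M (pball 0 (C * R / real k))"
    have "pball 0 R \<subseteq> (\<Union>a\<in>F. pball a (C * R / real k)) \<union> - V"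
      using F(4) by (auto simp: mem_pball)
    then have "emeasure M (pball 0 R) \<le> emeasure M ((\<Union>a\<in>F. pball a (C * R / real k)) \<union> - V)"
      using closed_V by (intro emeasure_mono) (auto intro!: borel_open open_Un open_UN)
    also have "\<dots> \<le> emeasure M (\<Union>a\<in>F. pball a (C * R / real k)) + emeasure M (- V)"
      using F(1) closed_V by (intro emeasure_subadditive) auto
    also have "\<dots> \<le> (\<Sum>a\<in>F. emeasure M (pball a (C * R / real k)))"
      using F(1) by (simp add: off_V) (intro emeasure_subadditive_finite, auto)
    also have "\<dots> = (\<Sum>a\<in>F. ennreal ?b)"
      using F(2) by (intro sum.cong emeasure_pball) auto
    also have "\<dots> = ennreal (real (card F) * ?b)"
      by (simp add: ennreal_mult ennreal_of_nat_eq_real_of_nat)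
    finally have "measure M (pball 0 R) \<le> real (card F) * ?b"
      by (simp add: emeasure_pball subspace_0[OF subspace_plane[OF V]])
    also have "\<dots> \<le> real ((3 * k) ^ m) * ?b"
      using F(3) by (intro mult_right_mono) (auto simp del: of_nat_power of_nat_mult)
    finally show "measure M (pball 0 R) \<le> real ((3 * k) ^ m) * ?b" .
  qed
qed

lemma doubling:
  assumes "0 < l"
  obtains K where "0 < K" "\<And>r. 0 < r \<Longrightarrow> measure M (pball 0 (l * r)) \<le> K * measure M (pball 0 r)"
proof -
  obtain C where C: "C > 0" "\<And>k R. k \<ge> 1 \<Longrightarrow> R > 0 \<Longrightarrow>
    measure M (pball 0 R) \<le> real ((3 * k) ^ m) * measure M (pball 0 (C * R / real k))"
    by (rule grid_bound[OF that])
  \<comment> \<open>With this \<open>k\<close>, the grid balls for the radius \<open>l * r\<close>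
    have radius at most \<open>r\<close>, whatever \<open>r\<close> is.\<close>
  obtain k :: nat where k: "C * l < real k" using reals_Archimedean2 by blast
  then have k1: "k \<ge> 1" using C(1) assms
    by (metis less_le_not_le linorder_not_less mult_pos_pos of_nat_0 less_one)
  show thesis
  proof (rule that[of "real ((3 * k) ^ m)"])
    fix r :: real assume r: "0 < r"
    have "C * (l * r) / real k \<le> r"
      using k k1 r mult_right_mono[of "C * l" "real k" r] by (simp add: divide_simps mult.assoc mult.commute)
    then have "real ((3 * k) ^ m) * measure M (pball 0 (C * (l * r) / real k)) \<le>
        real ((3 * k) ^ m) * measure M (pball 0 r)"
      by (intro mult_left_mono measure_pball_mono) auto
    then show "measure M (pball 0 (l * r)) \<le> real ((3 * k) ^ m) * measure M (pball 0 r)"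
      by (rule order_trans[OF C(2)[OF k1 mult_pos_pos[OF assms r]]])
  qed (use k1 in simp)
qed

lemma pball_lower_bound:
  obtains K where "0 < K" "\<And>r. 0 < r \<Longrightarrow> r \<le> 1 \<Longrightarrow> r ^ m \<le> K * measure M (pball 0 r)"
proof -
  obtain C where C: "C > 0" "\<And>k R. k \<ge> 1 \<Longrightarrow> R > 0 \<Longrightarrow>
    measure M (pball 0 R) \<le> real ((3 * k) ^ m) * measure M (pball 0 (C * R / real k))"
    by (rule grid_bound[OF that])
  let ?b = "measure M (pball 0 1)"
  have b: "0 < ?b" by (rule measure_pball_pos) simp
  show thesis
  proof (rule that[of "(3 * (C + 1)) ^ m / ?b"])
    fix r :: real assume r: "0 < r" "r \<le> 1"
    \<comment> \<open>The least \<open>k\<close> for which the unit ball is covered by balls of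
      radius at most \<open>r\<close>. It satisfies \<open>r * k \<le> C + 1\<close>, so the number
      of balls is of order \<open>1 / r ^ m\<close>.\<close>
    define k where "k = nat \<lceil>C / r\<rceil>"
    have "0 < C / r" using C(1) r by simp
    then have k: "k \<ge> 1" "C / r \<le> real k" "real k \<le> C / r + 1"
      unfolding k_def by (linarith, linarith, linarith)
    have "?b \<le> real ((3 * k) ^ m) * measure M (pball 0 (C * 1 / real k))"
      by (rule C(2)) (use k in auto)
    also have "\<dots> \<le> real ((3 * k) ^ m) * measure M (pball 0 r)"
      using k r by (intro mult_left_mono measure_pball_mono) (auto simp: field_simps)
    finally have "r ^ m * ?b \<le> r ^ m * (real ((3 * k) ^ m) * measure M (pball 0 r))"
      using r by (intro mult_left_mono) auto
    also have "\<dots> = (3 * (r * real k)) ^ m * measure M (pball 0 r)"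
      by (simp add: power_mult_distrib)
    also have "\<dots> \<le> (3 * (C + 1)) ^ m * measure M (pball 0 r)"
    proof (intro mult_right_mono power_mono mult_left_mono)
      have "r * real k \<le> r * (C / r + 1)" using k r by (intro mult_left_mono) auto
      also have "\<dots> \<le> C + 1" using r by (simp add: field_simps)
      finally show "r * real k \<le> C + 1" .
    qed (use r in auto)
    finally show "r ^ m \<le> (3 * (C + 1)) ^ m / ?b * measure M (pball 0 r)"
      using b by (simp add: field_simps)
  qed (use b C(1) in simp)
qed

text \<open>Outer regularity is applied to the restriction \<open>N\<close> of \<open>M\<close> to a
  ball, which is finite. Intersecting the open set with that ball brings the estimate back to
  \<open>M\<close>.\<close>

lemma outer_open:
  assumes "E \<in> sets borel" "E \<subseteq> pball 0 R" "0 < (e::real)"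
  obtains U where "open U" "E \<subseteq> U" "emeasure M U \<le> emeasure M E + ennreal e" "emeasure M E < \<infinity>"
proof -
  define N where "N = density M (indicator (pball 0 R))"
  have N: "emeasure N S = emeasure M (pball 0 R \<inter> S)" if "S \<in> sets borel" for S
    using that unfolding N_def by (intro emeasure_restricted) auto
  have sp: "space N = UNIV" by (simp add: N_def sets_eq_imp_space_eq[OF sets_M])
  have EN: "emeasure N E = emeasure M E"
    using assms(1,2) by (simp add: N Int_absorb1)
  have fin: "emeasure M E < \<infinity>"
    using finite_pball[of 0 R] assms(1,2) by (auto intro: le_less_trans[OF emeasure_mono])
  have "emeasure N E = (INF U \<in> {U. E \<subseteq> U \<and> open U}. emeasure N U)"
  proof (rule outer_regular)
    show "emeasure N (space N) \<noteq> \<infinity>"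
      using finite_pball[of 0 R] by (simp add: sp N)
  qed (use assms(1) in \<open>simp_all add: N_def\<close>)
  moreover have "emeasure N E < emeasure M E + ennreal e"
    using fin assms(3) by (simp add: EN ennreal_add_left_cancel_less[of _ 0, simplified])
  ultimately obtain U where U: "E \<subseteq> U" "open U" "emeasure N U < emeasure M E + ennreal e"
    by (auto simp: INF_less_iff)
  show thesis
    by (rule that[of "pball 0 R \<inter> U"]) (use U assms fin in \<open>auto simp: N intro: less_imp_le\<close>)
qed

text \<open>Disjoint Vitali balls inside an open set of small measure have small total measure. The
  lower bound for balls centred in \<open>V\<close> turns this into a small sum of powers of the
  diameters of the enlarged balls.\<close>

lemma hausdorff_null:
  assumes E: "E \<in> sets borel" "E \<subseteq> V" "emeasure M E = 0"
  shows "hausdorff m E = 0"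
proof -
  have bounded: "hausdorff m (E \<inter> pball 0 R) = 0" for R
  proof (rule hausdorff_0I)
    fix \<delta> e :: real assume "0 < \<delta>" "0 < e"
    obtain K where K: "0 < K" "\<And>r. 0 < r \<Longrightarrow> r \<le> 1 \<Longrightarrow> r ^ m \<le> K * measure M (pball 0 r)"
      by (rule pball_lower_bound[OF that])
    define e' where "e' = e / (10 ^ m * K)"
    have "0 < e'" using \<open>0 < e\<close> K(1) by (simp add: e'_def)
    have null: "emeasure M (E \<inter> pball 0 R) = 0"
      using E emeasure_eq_0[of E M "E \<inter> pball 0 R"] by simp
    have "E \<inter> pball 0 R \<in> sets borel" using E(1) by auto
    obtain U where U: "open U" "E \<inter> pball 0 R \<subseteq> U"
      "emeasure M U \<le> emeasure M (E \<inter> pball 0 R) + ennreal e'" "emeasure M (E \<inter> pball 0 R) < \<infinity>"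
      by (rule outer_open[OF \<open>E \<inter> pball 0 R \<in> sets borel\<close> Int_lower2 \<open>0 < e'\<close> that])
    \<comment> \<open>The bound 1 admits the lower bound on measures. With
      \<open>\<delta> / 20\<close>, the enlarged balls have diameter at most
      \<open>\<delta> / 2\<close>.\<close>
    define F where "F = {(p, r). p \<in> E \<inter> pball 0 R \<and> 0 < r \<and> r \<le> min 1 (\<delta> / 20) \<and> pball p r \<subseteq> U}"
    have F01: "0 < r \<and> r \<le> 1" if "(p, r) \<in> F" for p r
      using that by (auto simp: F_def)
    obtain c \<rho> where c: "\<And>i::nat. (c i, \<rho> i) \<in> F \<or> \<rho> i = 0"
      "disjoint_family (\<lambda>i. pball (c i) (\<rho> i))"
      "\<And>p r. (p, r) \<in> F \<Longrightarrow> pball p r \<subseteq> (\<Union>i. pball (c i) (5 * \<rho> i))"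
      by (rule parabolic_Vitali_covering[OF F01 that])
    have "E \<inter> pball 0 R \<subseteq> (\<Union>i. pball (c i) (5 * \<rho> i))"
    proof
      fix p assume p: "p \<in> E \<inter> pball 0 R"
      then obtain d where d: "0 < d" "\<And>r. r \<le> d \<Longrightarrow> pball p r \<subseteq> U"
        using open_contains_pball[OF U(1)] U(2) by blast
      define r where "r = min d (min 1 (\<delta> / 20))"
      have r: "0 < r" "r \<le> d" "r \<le> min 1 (\<delta> / 20)"
        using d(1) \<open>0 < \<delta>\<close> by (auto simp: r_def)
      then have "(p, r) \<in> F"
        using p d(2)[OF r(2)] unfolding F_def by blast
      moreover have "p \<in> pball p r" using r(1) by simp
      ultimately show "p \<in> (\<Union>i. pball (c i) (5 * \<rho> i))"
        by (rule subsetD[OF c(3)])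
    qed
    moreover have "pdiam (pball (c i) (5 * \<rho> i)) < ennreal \<delta>" for i
    proof -
      have "\<rho> i \<le> \<delta> / 20" using c(1)[of i] \<open>0 < \<delta>\<close> by (auto simp: F_def)
      then have "ennreal (2 * (5 * \<rho> i)) < ennreal \<delta>"
        using \<open>0 < \<delta>\<close> by (intro ennreal_lessI) auto
      with pdiam_pball_le show ?thesis by (rule le_less_trans)
    qed
    moreover have "(\<Sum>i. pdiam (pball (c i) (5 * \<rho> i)) ^ m) \<le> ennreal e"
    proof -
      have bound: "pdiam (pball (c i) (5 * \<rho> i)) ^ m \<le> ennreal (10 ^ m * K) * emeasure M (pball (c i) (\<rho> i))"
        for i
      proof (cases "\<rho> i = 0")
        \<comment> \<open>The padding balls contribute \<open>0 ^ m\<close>, which vanishes because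
          \<open>0 < m\<close>.\<close>
        case True
        have "pdiam ({} :: 'n parabolic set) = 0" by (simp add: pdiam_def bot_ennreal)
        then show ?thesis using True m_pos by simp
      next
        case False
        then have \<rho>: "c i \<in> V" "0 < \<rho> i" "\<rho> i \<le> 1" using c(1)[of i] E(2) by (auto simp: F_def)
        have "pdiam (pball (c i) (5 * \<rho> i)) ^ m \<le> ennreal (10 * \<rho> i) ^ m"
          using pdiam_pball_le[of "c i" "5 * \<rho> i"] by (intro power_mono) auto
        also have "\<dots> = ennreal (10 ^ m * \<rho> i ^ m)"
          using \<rho> by (simp add: ennreal_power power_mult_distrib)
        also have "\<dots> \<le> ennreal (10 ^ m * (K * measure M (pball 0 (\<rho> i))))"
          using K(2)[OF \<rho>(2,3)] by (intro ennreal_leI mult_left_mono) auto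
        also have "\<dots> = ennreal (10 ^ m * K) * emeasure M (pball (c i) (\<rho> i))"
          using K(1) \<rho>(1) by (simp add: emeasure_pball ennreal_mult' mult.assoc)
        finally show ?thesis .
      qed
      have "(\<Sum>i. pdiam (pball (c i) (5 * \<rho> i)) ^ m) \<le>
          (\<Sum>i. ennreal (10 ^ m * K) * emeasure M (pball (c i) (\<rho> i)))"
        using bound by (intro suminf_le) auto
      also have "\<dots> = ennreal (10 ^ m * K) * emeasure M (\<Union>i. pball (c i) (\<rho> i))"
        using c(2) by (subst suminf_emeasure[symmetric]) auto
      also have "\<dots> \<le> ennreal (10 ^ m * K) * emeasure M U"
      proof (intro mult_left_mono emeasure_mono)
        have "pball (c i) (\<rho> i) \<subseteq> U" for i using c(1)[of i] by (auto simp: F_def)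
        then show "(\<Union>i. pball (c i) (\<rho> i)) \<subseteq> U" by blast
      qed (use U in auto)
      also have "\<dots> \<le> ennreal (10 ^ m * K) * ennreal e'"
        using U(3) unfolding null by (intro mult_left_mono) auto
      also have "\<dots> = ennreal e"
        using K(1) \<open>0 < e'\<close> by (simp add: e'_def flip: ennreal_mult')
      finally show ?thesis .
    qed
    ultimately show "\<exists>B. E \<inter> pball 0 R \<subseteq> (\<Union>i. B i) \<and> (\<forall>i. pdiam (B i) < ennreal \<delta>) \<and>
        (\<Sum>i. pdiam (B i) ^ m) \<le> ennreal e"
      by (intro exI[of _ "\<lambda>i. pball (c i) (5 * \<rho> i)"]) auto
  qed
  have "E \<subseteq> (\<Union>k. E \<inter> pball 0 (real k))"
    using reals_Archimedean2 by (auto simp: mem_pball)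
  then show ?thesis
    by (rule hausdorff_0_mono[rotated]) (intro hausdorff_0_UN bounded)
qed

section \<open>Porosity and its negligibility\<close>

text \<open>The points range over the closure of \<open>B\<close>, and not over \<open>B\<close>,
  because \<open>B\<close> is arbitrary and the set has to be Borel.\<close>

definition porous_points :: "'n parabolic set \<Rightarrow> real \<Rightarrow> 'n parabolic set" where
  "porous_points B \<epsilon> = {p \<in> closure B \<inter> V. \<forall>k::nat. \<exists>r v. 0 < r \<and> r < 1 / real (Suc k) \<and> v \<in> V \<and>
     pnorm (v - p) < r \<and> pball v (\<epsilon> * r) \<inter> B = {}}"

text \<open>For fixed \<open>r\<close> and \<open>v\<close> the condition on \<open>p\<close> is
  open, so the existential quantifiers give open sets and the quantifier over \<open>k\<close> a
  countable intersection.\<close>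

lemma porous_points_borel: "porous_points B \<epsilon> \<in> sets borel"
proof -
  have "open {p. \<exists>r v. 0 < r \<and> r < 1 / real (Suc k) \<and> v \<in> V \<and> pnorm (v - p) < r \<and>
      pball v (\<epsilon> * r) \<inter> B = {}}" (is "open (?O k)") for k :: nat
    by (intro open_Collect_ex open_Collect_conj open_Collect_const open_pnorm_less continuous_intros)
  then have "closure B \<inter> V \<inter> (\<Inter>k. ?O k) \<in> sets borel"
    using closed_V by (intro sets.Int sets.countable_INT) (auto intro: borel_open)
  also have "closure B \<inter> V \<inter> (\<Inter>k. ?O k) = porous_points B \<epsilon>"
    unfolding porous_points_def by blast
  finally show ?thesis .
qed

text \<open>Each Vitali ball has a hole that misses \<open>E\<close> and carries a fixed fraction of
  the measure of the enlarged ball. All holes lie in an open \<open>U\<close> that exceeds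
  \<open>E\<close> by little in measure, so their total measure is small, and therefore so is that
  of \<open>E\<close>.\<close>

lemma emeasure_porous_points:
  assumes "0 < \<epsilon>" "\<epsilon> \<le> 1"
  shows "emeasure M (porous_points B \<epsilon>) = 0"
proof -
  have bounded: "emeasure M (porous_points B \<epsilon> \<inter> pball 0 R) = 0" for R
  proof -
    define E where "E = porous_points B \<epsilon> \<inter> pball 0 R"
    have E: "E \<in> sets borel" "E \<subseteq> pball 0 R" "E \<subseteq> V" "E \<subseteq> closure B"
      using porous_points_borel[of B \<epsilon>] by (auto simp: E_def porous_points_def)
    \<comment> \<open>The ratio of the enlarged radius \<open>5 * \<rho> i\<close> to the radius
      \<open>\<epsilon> * (\<rho> i / 2)\<close> of the hole.\<close>
    have l: "0 < 10 / \<epsilon>" using assms by simp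
    obtain K where K: "0 < K"
      "\<And>r. 0 < r \<Longrightarrow> measure M (pball 0 (10 / \<epsilon> * r)) \<le> K * measure M (pball 0 r)"
      by (rule doubling[OF l that])
    have "emeasure M E \<le> 0"
    proof (rule ennreal_le_epsilon)
      fix e :: real assume "0 < e"
      define e' where "e' = e / K"
      have "0 < e'" using \<open>0 < e\<close> K(1) by (simp add: e'_def)
      obtain U where U: "open U" "E \<subseteq> U" "emeasure M U \<le> emeasure M E + ennreal e'"
        "emeasure M E < \<infinity>"
        by (rule outer_open[OF E(1,2) \<open>0 < e'\<close> that])
      \<comment> \<open>Balls have twice the radius of the porosity scale. The hole, centred within
        \<open>r / 2\<close> and of radius at most \<open>r / 2\<close> as
        \<open>\<epsilon> \<le> 1\<close>, then lies inside the ball.\<close>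
      define F where "F = {(p, r). p \<in> E \<and> 0 < r \<and> r \<le> 1 \<and> pball p r \<subseteq> U \<and>
         (\<exists>v\<in>V. pnorm (v - p) < r / 2 \<and> pball v (\<epsilon> * (r / 2)) \<inter> B = {})}"
      have F01: "0 < r \<and> r \<le> 1" if "(p, r) \<in> F" for p r
        using that by (auto simp: F_def)
      obtain c \<rho> where c: "\<And>i::nat. (c i, \<rho> i) \<in> F \<or> \<rho> i = 0"
        "disjoint_family (\<lambda>i. pball (c i) (\<rho> i))"
        "\<And>p r. (p, r) \<in> F \<Longrightarrow> pball p r \<subseteq> (\<Union>i. pball (c i) (5 * \<rho> i))"
        by (rule parabolic_Vitali_covering[OF F01 that])
      have "E \<subseteq> (\<Union>i. pball (c i) (5 * \<rho> i))"
      proof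
        fix p assume p: "p \<in> E"
        then obtain d where d: "0 < d" "\<And>r. r \<le> d \<Longrightarrow> pball p r \<subseteq> U"
          using open_contains_pball[OF U(1)] U(2) by blast
        obtain k :: nat where k: "1 / real (Suc k) < min d 1 / 2"
          using d(1) reals_Archimedean[of "min d 1 / 2"] by (auto simp: inverse_eq_divide)
        obtain r v where rv: "0 < r" "r < 1 / real (Suc k)" "v \<in> V" "pnorm (v - p) < r"
          "pball v (\<epsilon> * r) \<inter> B = {}"
          using p unfolding E_def porous_points_def by blast
        have r: "2 * r \<le> d" "2 * r \<le> 1" using rv(2) k by linarith+
        have "(p, 2 * r) \<in> F"
          using p rv(1) r(2) d(2)[OF r(1)] rv(3-5) unfolding F_def by auto
        moreover have "p \<in> pball p (2 * r)" using rv(1) by simp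
        ultimately show "p \<in> (\<Union>i. pball (c i) (5 * \<rho> i))"
          by (rule subsetD[OF c(3)])
      qed
      have "\<exists>v. \<rho> i \<noteq> 0 \<longrightarrow> v \<in> V \<and> pnorm (v - c i) < \<rho> i / 2 \<and> pball v (\<epsilon> * (\<rho> i / 2)) \<inter> B = {}" for i
        using c(1)[of i] by (auto simp: F_def)
      then obtain v where v: "\<And>i. \<rho> i \<noteq> 0 \<Longrightarrow> v i \<in> V \<and> pnorm (v i - c i) < \<rho> i / 2 \<and>
          pball (v i) (\<epsilon> * (\<rho> i / 2)) \<inter> B = {}"
        by metis
      define h where "h = (\<lambda>i. pball (v i) (\<epsilon> * (\<rho> i / 2)))"
      have \<rho>: "0 \<le> \<rho> i" for i using c(1)[of i] by (auto simp: F_def)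
      have h_sub: "h i \<subseteq> pball (c i) (\<rho> i)" for i
      proof (cases "\<rho> i = 0")
        case False
        have "\<epsilon> * (\<rho> i / 2) \<le> 1 * (\<rho> i / 2)"
          using assms \<rho> by (intro mult_right_mono) auto
        then show ?thesis
          unfolding h_def using v[OF False] by (intro pball_subset) auto
      qed (simp add: h_def)
      have h_disj: "disjoint_family h"
        using c(2) h_sub unfolding disjoint_family_on_def by blast
      have "pball (c i) (\<rho> i) \<subseteq> U" for i using c(1)[of i] by (auto simp: F_def)
      then have hU: "(\<Union>i. h i) \<subseteq> U" using h_sub by blast
      \<comment> \<open>A hole is open and misses \<open>B\<close>, so it also misses the closure,
        where \<open>E\<close> lies.\<close>
      have "h i \<inter> closure B = {}" for i
      proof (cases "\<rho> i = 0")
        case False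
        then show ?thesis
          using v[OF False] unfolding h_def by (subst open_Int_closure_eq_empty) auto
      qed (simp add: h_def)
      then have hE: "(\<Union>i. h i) \<inter> E = {}" using E(4) by blast
      have h_meas: "h i \<in> sets borel" for i by (simp add: h_def)
      have "emeasure M E + emeasure M (\<Union>i. h i) = emeasure M (E \<union> (\<Union>i. h i))"
        using E(1) h_meas hE by (intro plus_emeasure) auto
      also have "\<dots> \<le> emeasure M U"
        using U(1,2) hU by (intro emeasure_mono) auto
      also note U(3)
      finally have holes: "emeasure M (\<Union>i. h i) \<le> ennreal e'"
        using U(4) by (auto simp: ennreal_add_left_cancel_le)
      have bound: "emeasure M (pball (c i) (5 * \<rho> i)) \<le> ennreal K * emeasure M (h i)" for i
      proof (cases "\<rho> i = 0")
        case False
        then have "c i \<in> V" using c(1)[of i] E(3) by (auto simp: F_def)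
        have "0 < \<epsilon> * (\<rho> i / 2)" using \<rho>[of i] False assms by simp
        from K(2)[OF this] have "measure M (pball 0 (5 * \<rho> i)) \<le> K * measure M (pball 0 (\<epsilon> * (\<rho> i / 2)))"
          using assms by simp
        then show ?thesis
          using \<open>c i \<in> V\<close> v[OF False] K(1) unfolding h_def
          by (simp add: emeasure_pball flip: ennreal_mult')
      qed simp
      have "emeasure M E \<le> emeasure M (\<Union>i. pball (c i) (5 * \<rho> i))"
        using \<open>E \<subseteq> (\<Union>i. pball (c i) (5 * \<rho> i))\<close> by (intro emeasure_mono) auto
      also have "\<dots> \<le> (\<Sum>i. emeasure M (pball (c i) (5 * \<rho> i)))"
        by (intro emeasure_subadditive_countably) auto
      also have "\<dots> \<le> (\<Sum>i. ennreal K * emeasure M (h i))"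
        using bound by (intro suminf_le) auto
      also have "\<dots> = ennreal K * emeasure M (\<Union>i. h i)"
        using h_disj h_meas by (subst suminf_emeasure[symmetric]) auto
      also have "\<dots> \<le> ennreal K * ennreal e'"
        using holes by (intro mult_left_mono) auto
      also have "\<dots> = ennreal e"
        using K(1) \<open>0 < e'\<close> by (simp add: e'_def flip: ennreal_mult')
      finally show "emeasure M E \<le> 0 + ennreal e" by simp
    qed
    then show ?thesis by (simp add: E_def)
  qed
  have "porous_points B \<epsilon> = (\<Union>k::nat. porous_points B \<epsilon> \<inter> pball 0 (real k))"
    using reals_Archimedean2 by (auto simp: mem_pball)
  moreover have "emeasure M (\<Union>k::nat. porous_points B \<epsilon> \<inter> pball 0 (real k)) = 0"
    using porous_points_borel by (intro emeasure_UN_eq_0 bounded) auto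
  ultimately show ?thesis by metis
qed

end

definition dense_point :: "'n::finite parabolic set \<Rightarrow> 'n parabolic set \<Rightarrow> 'n parabolic \<Rightarrow> bool" where
  "dense_point V B p \<longleftrightarrow> (\<forall>e>0. \<exists>d>0. \<forall>r v. 0 < r \<and> r < d \<and> v \<in> V \<and> pnorm (v - p) < r \<longrightarrow>
     (\<exists>q\<in>B. pnorm (q - v) < e * r))"

text \<open>Failure of density for some \<open>e\<close> is porosity for every
  \<open>1 / real (Suc j)\<close> below \<open>e\<close>, so countably many null sets
  suffice.\<close>

theorem almost_all_dense_points:
  fixes V :: "'n::finite parabolic set"
  assumes "V \<in> planes m" "B \<subseteq> V"
  shows "hausdorff m {p \<in> B. \<not> dense_point V B p} = 0"
proof -
  obtain M where "plane_measure V m M" using exists_plane_measure[OF assms(1)] by blast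
  then interpret plane_measure V m M .
  have "{p \<in> B. \<not> dense_point V B p} \<subseteq> (\<Union>j. porous_points B (1 / real (Suc j)))"
  proof
    fix p assume "p \<in> {p \<in> B. \<not> dense_point V B p}"
    then have "p \<in> B" and nd: "\<not> dense_point V B p" by auto
    then have p: "p \<in> closure B \<inter> V"
      using assms(2) closure_subset[of B] by auto
    define Q where "Q e r v \<longleftrightarrow> (\<exists>q\<in>B. pnorm (q - v) < e * r)" for e r v
    obtain e where "e > 0" and e: "\<not> (\<exists>d>0. \<forall>r v. 0 < r \<and> r < d \<and> v \<in> V \<and> pnorm (v - p) < r \<longrightarrow> Q e r v)"
      using nd unfolding dense_point_def Q_def[symmetric] by auto
    obtain j :: nat where j: "1 / real (Suc j) < e"
      using reals_Archimedean[OF \<open>e > 0\<close>] by (auto simp: inverse_eq_divide)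
    have "\<exists>r v. 0 < r \<and> r < 1 / real (Suc k) \<and> v \<in> V \<and> pnorm (v - p) < r \<and>
        pball v (1 / real (Suc j) * r) \<inter> B = {}" for k :: nat
    proof -
      obtain r v where rv: "0 < r" "r < 1 / real (Suc k)" "v \<in> V" "pnorm (v - p) < r"
        "\<not> Q e r v"
        using e of_nat_0_less_iff zero_less_Suc zero_less_divide_1_iff by metis
      have "1 / real (Suc j) * r \<le> e * r" using j rv(1) by (intro mult_right_mono) auto
      then have "pball v (1 / real (Suc j) * r) \<inter> B = {}"
        using rv(5) unfolding Q_def by (force simp: mem_pball)
      then show ?thesis using rv by blast
    qed
    then show "p \<in> (\<Union>j. porous_points B (1 / real (Suc j)))"
      using p unfolding porous_points_def by blast
  qed
  moreover have "hausdorff m (\<Union>j. porous_points B (1 / real (Suc j))) = 0"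
    by (intro hausdorff_0_UN hausdorff_null porous_points_borel emeasure_porous_points)
      (auto simp: porous_points_def)
  ultimately show ?thesis by (rule hausdorff_0_mono[rotated])
qed

section \<open>Approximate differentials\<close>

text \<open>Otherwise \<open>W\<close> contains a unit vector orthogonal to \<open>T\<close>, whose
  distance from every point of \<open>T\<close> is at least 1.\<close>

lemma half_dense_subspace_eq:
  fixes T W :: "'a::euclidean_space set"
  assumes T: "subspace T" and W: "subspace W" and "T \<subseteq> W"
    and dense: "\<And>y. y \<in> W \<Longrightarrow> norm y = 1 \<Longrightarrow> \<exists>x\<in>T. norm (x - y) \<le> 1 / 2"
  shows "T = W"
proof (rule ccontr)
  assume "T \<noteq> W"
  then have TW: "span T \<subset> span W"
    using assms(3) T W by (simp add: psubset_eq span_eq_iff[THEN iffD2])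
  obtain u where u: "u \<noteq> 0" "u \<in> span W" "\<And>y. y \<in> span T \<Longrightarrow> orthogonal u y"
    by (rule orthogonal_to_subspace_exists_gen[OF TW that])
  define y where "y = u /\<^sub>R norm u"
  have "y \<in> W" "norm y = 1"
    using u(1,2) W by (auto simp: y_def span_eq_iff[THEN iffD2] intro: subspace_scale)
  then obtain x where x: "x \<in> T" "norm (x - y) \<le> 1 / 2"
    using dense by blast
  have "orthogonal u x" using u(3) span_base[OF x(1)] by blast
  then have "orthogonal x (- y)"
    by (simp add: y_def orthogonal_def inner_commute)
  then have "(norm (x - y))\<^sup>2 = (norm x)\<^sup>2 + 1"
    using norm_add_Pythagorean[of x "- y"] \<open>norm y = 1\<close> by simp
  then have "1\<^sup>2 \<le> (norm (x - y))\<^sup>2" by simp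
  then have "1 \<le> norm (x - y)"
    by (rule power2_le_imp_le) simp
  with x(2) show False by simp
qed

text \<open>\<open>S\<close> inverts \<open>P\<close> on \<open>W'\<close>. Its norm bound is the point: iterating the half-density
  \<open>S y = x + S (y - P x)\<close> gives \<open>onorm S \<le> c + onorm S / 2\<close>.\<close>

lemma projection_section:
  fixes W W' :: "'a::euclidean_space set"
  assumes W: "subspace W" and W': "subspace W'" and dim: "dim W' \<le> dim W"
    and P: "linear P" "\<And>x. P x \<in> W" "\<And>w. w \<in> W \<Longrightarrow> P w = w" "\<And>x. norm (P x) \<le> norm x"
    and "0 \<le> c"
    and dense: "\<And>y. y \<in> W \<Longrightarrow> norm y = 1 \<Longrightarrow> \<exists>x\<in>W'. norm (P x - y) \<le> 1 / 2 \<and> norm x \<le> c"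
  shows "\<exists>S. linear S \<and> (\<forall>x\<in>W'. S (P x) = x) \<and> (\<forall>y\<in>W. P (S y) = y) \<and>
    (\<forall>y. norm (S y) \<le> 2 * c * norm y)"
proof -
  have PW': "P ` W' = W"
  proof (rule half_dense_subspace_eq)
    show "subspace (P ` W')" using P(1) W' by (rule linear_subspace_image)
    show "P ` W' \<subseteq> W" using P(2) by blast
    show "\<exists>x\<in>P ` W'. norm (x - y) \<le> 1 / 2" if "y \<in> W" "norm y = 1" for y
      using dense[OF that] by blast
  qed fact
  obtain R where R: "R ` UNIV \<subseteq> W'" "linear R" "\<forall>v\<in>P ` W'. P (R v) = v"
    using linear_exists_right_inverse_on[OF P(1) W'] by metis
  then have PR: "P (R y) = y" if "y \<in> W" for y
    using that PW' by blast
  \<comment> \<open>The right inverse is injective on \<open>W\<close>, so by the bound on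
    \<open>dim W'\<close> it fills \<open>W'\<close>. Hence it is also a left inverse of
    \<open>P\<close> on \<open>W'\<close>.\<close>
  have "R ` W = W'"
  proof (rule subspace_dim_equal)
    show "subspace (R ` W)" using R(2) W by (rule linear_subspace_image)
    show "R ` W \<subseteq> W'" using R(1) by blast
    have "inj_on R (span W)"
      using W PR by (intro inj_onI) (metis span_eq_iff)
    then have "dim (R ` W) = dim W"
      by (rule dim_image_eq[OF R(2)])
    then show "dim W' \<le> dim (R ` W)" using dim by simp
  qed fact
  then have RP: "R (P x) = x" if "x \<in> W'" for x
    using that PR by (metis imageE)
  \<comment> \<open>Composition with \<open>P\<close> removes the uncontrolled values of
    \<open>R\<close> off \<open>W\<close>, so the operator norm of \<open>S\<close> is governed by
    unit vectors of \<open>W\<close>.\<close>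
  define S where "S = (\<lambda>x. R (P x))"
  have lin: "linear S"
    unfolding S_def using linear_compose[OF P(1) R(2)] by (simp add: o_def)
  then have bl: "bounded_linear S" by (simp add: linear_conv_bounded_linear)
  have SW': "S (P x) = x" if "x \<in> W'" for x
    using that RP P(2,3) by (simp add: S_def)
  have unit: "norm (S y) \<le> c + onorm S / 2" if y: "y \<in> W" "norm y = 1" for y
  proof -
    obtain x where x: "x \<in> W'" "norm (P x - y) \<le> 1 / 2" "norm x \<le> c"
      using dense[OF y] by blast
    have "norm (S (y - P x)) \<le> onorm S * norm (y - P x)"
      by (rule onorm[OF bl])
    also have "\<dots> \<le> onorm S * (1 / 2)"
      using x(2) onorm_pos_le[OF bl] by (intro mult_left_mono) (auto simp: norm_minus_commute)
    finally have "norm (S (y - P x)) \<le> onorm S / 2" by simp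
    moreover have "S y = x + S (y - P x)"
      using SW'[OF x(1)] by (simp add: linear_diff[OF lin])
    ultimately show ?thesis
      using x(3) norm_triangle_ineq[of x "S (y - P x)"] by simp
  qed
  have "norm (S z) \<le> (c + onorm S / 2) * norm z" for z
  proof (cases "P z = 0")
    case True
    then show ?thesis
      using \<open>0 \<le> c\<close> onorm_pos_le[OF bl] linear_0[OF R(2)] by (simp add: S_def)
  next
    case False
    have "S z = norm (P z) *\<^sub>R S (P z /\<^sub>R norm (P z))"
      using False P(2,3) by (simp add: linear_scale[OF lin]) (simp add: S_def)
    then have "norm (S z) = norm (P z) * norm (S (P z /\<^sub>R norm (P z)))"
      by simp
    also have "\<dots> \<le> norm (P z) * (c + onorm S / 2)"
      using False P(2) W by (intro mult_left_mono unit) (auto simp: subspace_scale)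
    also have "\<dots> \<le> norm z * (c + onorm S / 2)"
      using P(4) \<open>0 \<le> c\<close> onorm_pos_le[OF bl] by (intro mult_right_mono) auto
    finally show ?thesis by (simp add: mult.commute)
  qed
  then have "onorm S \<le> c + onorm S / 2"
    by (rule onorm_bound[rotated]) (use \<open>0 \<le> c\<close> onorm_pos_le[OF bl] in simp)
  then have le: "onorm S \<le> 2 * c" by simp
  have "norm (S y) \<le> 2 * c * norm y" for y
    using onorm[OF bl, of y] mult_right_mono[OF le, of "norm y"] by simp
  moreover have "P (S y) = y" if "y \<in> W" for y
    using that PR P(3) by (simp add: S_def)
  ultimately show ?thesis using lin SW' by blast
qed

text \<open>A form of the case distinction in which two planes can be treated side by side through
  their space parts.\<close>

lemma plane_space_part:
  assumes "V \<in> planes m"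
  shows "subspace (fst ` V)" "\<And>x. x \<in> fst ` V \<Longrightarrow> (x, 0) \<in> V"
    "((\<forall>v\<in>V. snd v = 0) \<and> dim (fst ` V) = m) \<or>
      ((\<forall>v\<in>V. \<forall>t. (fst v, t) \<in> V) \<and> dim (fst ` V) + 2 = m)"
proof -
  have "subspace (fst ` V) \<and> (\<forall>x\<in>fst ` V. (x, 0) \<in> V) \<and>
    (((\<forall>v\<in>V. snd v = 0) \<and> dim (fst ` V) = m) \<or>
      ((\<forall>v\<in>V. \<forall>t. (fst v, t) \<in> V) \<and> dim (fst ` V) + 2 = m))"
    using assms
  proof (cases rule: planes_cases)
    case (horizontal W)
    then have "fst ` V = W" by force
    then show ?thesis using horizontal by auto
  next
    case (vertical W)
    then have "fst ` V = W" by force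
    then show ?thesis using vertical by auto
  qed
  then show "subspace (fst ` V)" "\<And>x. x \<in> fst ` V \<Longrightarrow> (x, 0) \<in> V"
    "((\<forall>v\<in>V. snd v = 0) \<and> dim (fst ` V) = m) \<or>
      ((\<forall>v\<in>V. \<forall>t. (fst v, t) \<in> V) \<and> dim (fst ` V) + 2 = m)"
    by blast+
qed

text \<open>The scale becomes the distance of \<open>v\<close> from \<open>p\<close>. Since the
  radius in \<open>dense_point\<close> must exceed that distance, twice the distance is used, with
  \<open>e / 2\<close> for \<open>e\<close>.\<close>

lemma dense_pointD:
  assumes "dense_point V B p" "0 < e"
  obtains d where "0 < d" "\<And>v. v \<in> V \<Longrightarrow> v \<noteq> p \<Longrightarrow> pnorm (v - p) < d \<Longrightarrow>
    \<exists>q\<in>B. pnorm (q - v) < e * pnorm (v - p)"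
proof -
  obtain d where d: "0 < d" "\<forall>r v. 0 < r \<and> r < d \<and> v \<in> V \<and> pnorm (v - p) < r \<longrightarrow>
     (\<exists>q\<in>B. pnorm (q - v) < e / 2 * r)"
    using assms unfolding dense_point_def by (metis half_gt_zero)
  show thesis
  proof (rule that[of "d / 2"])
    fix v assume v: "v \<in> V" "v \<noteq> p" "pnorm (v - p) < d / 2"
    then have "0 < pnorm (v - p)" by simp
    then have "\<exists>q\<in>B. pnorm (q - v) < e / 2 * (2 * pnorm (v - p))"
      using d(2)[rule_format, of "2 * pnorm (v - p)" v] v by simp
    then show "\<exists>q\<in>B. pnorm (q - v) < e * pnorm (v - p)" by simp
  qed (use d in simp)
qed

text \<open>The chord of two graph points projects to the difference of their base points, which is
  no longer than the chord and differs from it by \<open>h a - h b\<close>. The absolute value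
  covers a negative Lipschitz constant.\<close>

lemma graph_chord_near_plane:
  assumes "lipschitz_graph m \<epsilon> G"
  obtains V' where "V' \<in> planes m"
    "\<And>x y. x \<in> G \<Longrightarrow> y \<in> G \<Longrightarrow> \<exists>w\<in>V'. pnorm (x - y - w) \<le> \<bar>\<epsilon>\<bar> * pnorm (x - y)"
proof -
  obtain V' A h where V': "V' \<in> planes m" and A: "A \<subseteq> V'" and h: "h \<in> A \<rightarrow> orthogonal_comp V'"
    "parabolic_lipschitz \<epsilon> A h" and G: "G = graph_over A h"
    using assms unfolding lipschitz_graph_def by blast
  obtain P where P: "linear P" "\<And>x. P x \<in> V'" "\<And>v. v \<in> V' \<Longrightarrow> P v = v"
    "\<And>w. w \<in> orthogonal_comp V' \<Longrightarrow> P w = 0" "\<And>x. x - P x \<in> orthogonal_comp V'"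
    "\<And>x. pnorm (P x) \<le> pnorm x" "\<And>x. pnorm (x - P x) \<le> pnorm x"
    using plane_projection[OF V'] by blast
  show thesis
  proof (rule that[OF V'])
    fix x y assume "x \<in> G" "y \<in> G"
    then obtain a b where ab: "a \<in> A" "b \<in> A" "x = a + h a" "y = b + h b"
      unfolding G graph_over_def by blast
    then have hab: "P (h a) = 0" "P (h b) = 0" "P a = a" "P b = b"
      using h(1) A P(3,4) by blast+
    have "P (x - y) = a - b"
      using hab by (simp add: ab linear_add[OF P(1)] linear_diff[OF P(1)])
    then have le: "pnorm (a - b) \<le> pnorm (x - y)"
      using P(6)[of "x - y"] by simp
    have "x - y - (a - b) = h a - h b" by (simp add: ab)
    then have "pnorm (x - y - (a - b)) \<le> \<epsilon> * pnorm (a - b)"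
      using h(2) ab(1,2) by (simp add: parabolic_lipschitz_def)
    also have "\<dots> \<le> \<bar>\<epsilon>\<bar> * pnorm (a - b)"
      by (intro mult_right_mono) auto
    also have "\<dots> \<le> \<bar>\<epsilon>\<bar> * pnorm (x - y)"
      using le by (intro mult_left_mono) auto
    finally show "\<exists>w\<in>V'. pnorm (x - y - w) \<le> \<bar>\<epsilon>\<bar> * pnorm (x - y)"
      using A ab(1,2) subspace_diff[OF subspace_plane[OF V']] by blast
  qed
qed

text \<open>The bound on \<open>\<Lambda>\<close> is independent of \<open>\<epsilon>\<close>, which
  gives compactness as \<epsilon> tends to 0, while the error is linear in
  \<open>\<epsilon>\<close>. The smallness of \<open>\<epsilon> * (1 + L)\<close> forces
  \<open>V'\<close> to project onto the space part of \<open>V\<close>.\<close>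

lemma approximate_differential:
  fixes V :: "'n::finite parabolic set"
  assumes V: "V \<in> planes m" and A: "A \<subseteq> V" and g: "g \<in> A \<rightarrow> orthogonal_comp V"
    and lip: "parabolic_lipschitz L A g" and L: "0 \<le> L"
    and B: "B \<subseteq> A" "p \<in> B" "dense_point V B p"
    and G: "lipschitz_graph m \<epsilon> G" "\<And>q. q \<in> B \<Longrightarrow> q + g q \<in> G"
    and \<epsilon>: "0 < \<epsilon>" "\<epsilon> * (1 + L) \<le> 1 / 8"
  shows "\<exists>\<Lambda>. linear \<Lambda> \<and> (\<forall>y. norm (\<Lambda> y) \<le> 5 * (1 + L) * norm y) \<and>
    (\<forall>y\<in>fst ` V. (\<Lambda> y, 0) \<in> orthogonal_comp V) \<and>
    (\<exists>d>0. \<forall>q\<in>A. pnorm (q - p) < d \<longrightarrow>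
       pnorm (g q - g p - (\<Lambda> (fst q - fst p), 0)) \<le> 18 * (1 + L)\<^sup>2 * \<epsilon> * pnorm (q - p))"
proof -
  define W where "W = fst ` V"
  note W = plane_space_part[OF V, folded W_def]
  have pA: "p \<in> A" and pV: "p \<in> V" using A B by auto
  have subV: "subspace V" by (rule subspace_plane[OF V])
  \<comment> \<open>The chord \<open>z q\<close> has length at most
    \<open>(1 + L) * pnorm (q - p)\<close>, so an error \<epsilon> relative to the chord is an error
    \<kappa> relative to \<open>q - p\<close>.\<close>
  define \<kappa> where "\<kappa> = \<epsilon> * (1 + L)"
  have \<kappa>: "0 < \<kappa>" "\<kappa> \<le> 1 / 8" using \<epsilon> L by (auto simp: \<kappa>_def)
  obtain V' where V': "V' \<in> planes m"
    "\<And>x y. x \<in> G \<Longrightarrow> y \<in> G \<Longrightarrow> \<exists>w\<in>V'. pnorm (x - y - w) \<le> \<bar>\<epsilon>\<bar> * pnorm (x - y)"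
    by (rule graph_chord_near_plane[OF G(1) that])
  define W' where "W' = fst ` V'"
  note W' = plane_space_part[OF V'(1), folded W'_def]
  define z where "z = (\<lambda>q. (q - p) + (g q - g p))"
  have z_le: "pnorm (z q) \<le> (1 + L) * pnorm (q - p)" if "q \<in> A" for q
    using lip that pA pnorm_add[of "q - p" "g q - g p"]
    by (fastforce simp: z_def parabolic_lipschitz_def algebra_simps)
  have near: "\<exists>w\<in>V'. pnorm (z q - w) \<le> \<kappa> * pnorm (q - p)" if q: "q \<in> B" for q
  proof -
    obtain w where w: "w \<in> V'" "pnorm ((q + g q) - (p + g p) - w) \<le> \<bar>\<epsilon>\<bar> * pnorm ((q + g q) - (p + g p))"
      using V'(2)[OF G(2)[OF q] G(2)[OF B(2)]] by blast
    have eq: "(q + g q) - (p + g p) = z q" by (simp add: z_def)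
    have "pnorm (z q - w) \<le> \<epsilon> * pnorm (z q)"
      using w(2) \<epsilon>(1) unfolding eq by simp
    also have "\<dots> \<le> \<epsilon> * ((1 + L) * pnorm (q - p))"
      using z_le[of q] q B(1) \<epsilon>(1) by (intro mult_left_mono) auto
    finally show ?thesis using w(1) by (auto simp: \<kappa>_def mult.assoc)
  qed
  obtain P where P: "linear P" "\<And>x. P x \<in> W" "\<And>x w. w \<in> W \<Longrightarrow> (x - P x) \<bullet> w = 0"
    "\<And>w. w \<in> W \<Longrightarrow> P w = w" "\<And>x. norm (P x) \<le> norm x" "\<And>x. norm (x - P x) \<le> norm x"
    "\<And>x. (\<And>w. w \<in> W \<Longrightarrow> x \<bullet> w = 0) \<Longrightarrow> P x = 0"
    using subspace_orthogonal_projection[OF W(1)] by blast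
  have orth: "v \<bullet> g q = 0" if "q \<in> A" "v \<in> V" for q v
    using g that by (auto simp: orthogonal_comp_def orthogonal_def Pi_iff)
  have Pg: "P (fst (g q)) = 0" if "q \<in> A" for q
  proof (rule P(7))
    fix w assume "w \<in> W"
    then show "fst (g q) \<bullet> w = 0"
      using orth[OF that W(2)] by (cases "g q") (auto simp: inner_commute)
  qed
  have fstW: "fst q - fst p \<in> W" if "q \<in> V" for q
    using subspace_diff[OF subV that pV] unfolding W_def by (metis fst_diff imageI)
  have Pz: "P (fst (z q)) = fst q - fst p" if "q \<in> A" for q
    using Pg[OF that] Pg[OF pA] P(4)[OF fstW[of q]] A that
    by (auto simp: z_def linear_add[OF P(1)] linear_diff[OF P(1)])
  obtain d where d: "0 < d" "\<And>v. v \<in> V \<Longrightarrow> v \<noteq> p \<Longrightarrow> pnorm (v - p) < d \<Longrightarrow>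
    \<exists>q\<in>B. pnorm (q - v) < 1 / 4 * pnorm (v - p)"
    by (rule dense_pointD[OF B(3), of "1 / 4", OF _ that]) simp
  define r where "r = d / 2"
  have r: "0 < r" "r < d" using d(1) by (auto simp: r_def)
  \<comment> \<open>The point \<open>p + pdil r v\<close> has distance exactly \<open>r\<close> from
    \<open>p\<close>, and density with constant 1/4 puts a point \<open>q\<close> of
    \<open>B\<close> within \<open>r / 4\<close> of it. One scale \<open>r\<close> is
    enough.\<close>
  have probe: "\<exists>q\<in>B. \<exists>w\<in>V'. pnorm (q - p - pdil r v) < r / 4 \<and> pnorm (q - p) \<le> 5 / 4 * r \<and>
      pnorm (z q - w) \<le> \<kappa> * (5 / 4 * r)" if v: "v \<in> V" "pnorm v = 1" for v
  proof -
    have pn: "pnorm (pdil r v) = r" using v(2) r by simp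
    then have ne: "p + pdil r v \<noteq> p" using r by (metis add_cancel_left_right pnorm_0 less_irrefl)
    have "p + pdil r v \<in> V"
      using pV pdil_plane[OF V v(1)] subV by (intro subspace_add)
    from d(2)[OF this ne] obtain q where q: "q \<in> B" "pnorm (q - (p + pdil r v)) < 1 / 4 * r"
      using pn r by auto
    then have 1: "pnorm (q - p - pdil r v) < r / 4" by (simp add: algebra_simps)
    have 2: "pnorm (q - p) \<le> 5 / 4 * r"
      using pnorm_add[of "q - p - pdil r v" "pdil r v"] 1 pn by simp
    obtain w where "w \<in> V'" "pnorm (z q - w) \<le> \<kappa> * pnorm (q - p)"
      using near[OF q(1)] by blast
    moreover have "\<kappa> * pnorm (q - p) \<le> \<kappa> * (5 / 4 * r)"
      using 2 \<kappa> by (intro mult_left_mono) auto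
    ultimately show ?thesis using q(1) 1 2 by force
  qed
  \<comment> \<open>The vector is \<open>fst w / r\<close> for the point \<open>w\<close> of
    \<open>V'\<close> near the chord to \<open>q\<close>. The errors 1/4 from density and 5/32 from
    \<open>\<kappa> \<le> 1 / 8\<close> add up to less than 1/2.\<close>
  have half: "\<exists>x\<in>W'. norm (P x - y) \<le> 1 / 2 \<and> norm x \<le> 2 * (1 + L)"
    if y: "y \<in> W" "norm y = 1" for y
  proof -
    obtain q w where qw: "q \<in> B" "w \<in> V'" "pnorm (q - p - pdil r (y, 0)) < r / 4"
      "pnorm (q - p) \<le> 5 / 4 * r" "pnorm (z q - w) \<le> \<kappa> * (5 / 4 * r)"
      using probe[of "(y, 0)"] W(2)[OF y(1)] y(2) by auto
    have qA: "q \<in> A" using qw(1) B(1) by auto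
    have \<kappa>r: "\<kappa> * (5 / 4 * r) \<le> 1 / 8 * (5 / 4 * r)"
      using \<kappa> r by (intro mult_right_mono) auto
    have zw: "norm (fst (z q) - fst w) \<le> 5 / 32 * r"
      using norm_fst_le_pnorm[of "z q - w"] qw(5) \<kappa>r by simp
    have qy: "norm (fst q - fst p - r *\<^sub>R y) \<le> r / 4"
      using norm_fst_le_pnorm[of "q - p - pdil r (y, 0)"] qw(3) by (simp add: pdil_def)
    have zq: "norm (fst (z q)) \<le> (1 + L) * (5 / 4 * r)"
    proof -
      have "norm (fst (z q)) \<le> (1 + L) * pnorm (q - p)"
        using norm_fst_le_pnorm[of "z q"] z_le[OF qA] by linarith
      also have "\<dots> \<le> (1 + L) * (5 / 4 * r)"
        using qw(4) L by (intro mult_left_mono) auto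
      finally show ?thesis .
    qed
    define x where "x = fst w /\<^sub>R r"
    have w_eq: "fst w = r *\<^sub>R x" using r by (simp add: x_def)
    have "x \<in> W'"
      using qw(2) W'(1) by (auto simp: x_def W'_def intro: subspace_scale)
    moreover have "r * norm (P x - y) \<le> r * (1 / 2)"
    proof -
      have "r * norm (P x - y) = norm (P (fst w) - r *\<^sub>R y)"
        using r by (simp add: w_eq linear_scale[OF P(1)] flip: scaleR_diff_right)
      also have "P (fst w) - r *\<^sub>R y = (fst q - fst p - r *\<^sub>R y) - P (fst (z q) - fst w)"
        using Pz[OF qA] by (simp add: linear_diff[OF P(1)])
      also have "norm \<dots> \<le> r / 4 + 5 / 32 * r"
        using norm_triangle_ineq4[of "fst q - fst p - r *\<^sub>R y" "P (fst (z q) - fst w)"]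
          qy zw P(5)[of "fst (z q) - fst w"] by linarith
      finally show ?thesis using r by simp
    qed
    moreover have "r * norm x \<le> r * (2 * (1 + L))"
    proof -
      have "r * norm x = norm (fst w)" using r by (simp add: w_eq)
      also have "\<dots> \<le> norm (fst (z q)) + norm (fst (z q) - fst w)"
        using norm_triangle_sub[of "fst w" "fst (z q)"] by (simp add: norm_minus_commute)
      also have "\<dots> \<le> (1 + L) * (5 / 4 * r) + 5 / 32 * r"
        using zq zw by linarith
      also have "\<dots> \<le> r * (2 * (1 + L))"
      proof -
        have "r * 1 \<le> r * (1 + L)" using r L by (intro mult_left_mono) auto
        moreover have "(1 + L) * (5 / 4 * r) = 5 / 4 * (r * (1 + L))"
          "r * (2 * (1 + L)) = 2 * (r * (1 + L))"
          by simp_all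
        ultimately show ?thesis using r by linarith
      qed
      finally show ?thesis .
    qed
    ultimately show ?thesis using r(1) by (intro bexI[of _ x]) simp_all
  qed
  have dim_le: "dim W \<le> dim W'"
  proof -
    have "P ` W' = W"
    proof (rule half_dense_subspace_eq)
      show "subspace (P ` W')" using P(1) W'(1) by (rule linear_subspace_image)
      show "P ` W' \<subseteq> W" using P(2) by blast
      show "\<exists>x\<in>P ` W'. norm (x - y) \<le> 1 / 2" if "y \<in> W" "norm y = 1" for y
        using half[OF that] by blast
    qed (rule W(1))
    then show ?thesis using dim_image_le[OF P(1), of W'] by simp
  qed
  \<comment> \<open>Over a vertical \<open>V\<close> the values of \<open>g\<close> have no time
    component. Probing in the time direction then gives chords with time component close to
    \<open>r\<^sup>2\<close>, which cannot be near a horizontal \<open>V'\<close>.\<close>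
  have vertical: "\<not> (\<forall>v\<in>V'. snd v = 0)" if vert: "\<forall>v\<in>V. \<forall>t. (fst v, t) \<in> V"
  proof
    assume hor: "\<forall>v\<in>V'. snd v = 0"
    have V01: "(0, t) \<in> V" for t
      using vert subspace_0[OF subV] by fastforce
    have snd0: "snd (g q) = 0" if "q \<in> A" for q
      using orth[OF that V01[of 1]] by (cases "g q") simp
    obtain q w where qw: "q \<in> B" "w \<in> V'" "pnorm (q - p - pdil r (0, 1)) < r / 4"
      "pnorm (q - p) \<le> 5 / 4 * r" "pnorm (z q - w) \<le> \<kappa> * (5 / 4 * r)"
      using probe[of "(0, 1)"] V01[of 1] by (auto simp: pnorm_def)
    have "\<kappa> * (5 / 4 * r) \<le> 1 / 8 * (5 / 4 * r)"
      using \<kappa> r by (intro mult_right_mono) auto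
    then have "pnorm (z q - w) \<le> r / 4" using qw(5) r(1) by linarith
    then have "(pnorm (z q - w))\<^sup>2 \<le> (r / 4)\<^sup>2" by (rule power_mono) simp
    then have "\<bar>snd (z q - w)\<bar> \<le> (r / 4)\<^sup>2"
      using abs_snd_le_pnorm[of "z q - w"] by linarith
    then have 1: "\<bar>snd q - snd p\<bar> \<le> (r / 4)\<^sup>2"
      using snd0[of q] snd0[OF pA] qw(1,2) B(1) hor by (auto simp: z_def)
    have "(pnorm (q - p - pdil r (0, 1)))\<^sup>2 \<le> (r / 4)\<^sup>2"
      using qw(3) by (intro power_mono) auto
    then have "\<bar>snd (q - p - pdil r (0, 1))\<bar> \<le> (r / 4)\<^sup>2"
      using abs_snd_le_pnorm[of "q - p - pdil r (0, 1)"] by linarith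
    then have "\<bar>snd q - snd p - r\<^sup>2\<bar> \<le> (r / 4)\<^sup>2"
      by (simp add: pdil_def)
    with 1 have "r\<^sup>2 \<le> 2 * (r / 4)\<^sup>2" by linarith
    then show False using r(1) by (simp add: power_divide)
  qed
  \<comment> \<open>If \<open>V\<close> is horizontal, \<open>dim W = m\<close> is the largest
    possible value. If \<open>V\<close> is vertical, so is \<open>V'\<close>, and both dimensions
    are \<open>m - 2\<close>.\<close>
  have dim_ge: "dim W' \<le> dim W"
    using W(3) W'(3) vertical by auto
  have "\<exists>S. linear S \<and> (\<forall>x\<in>W'. S (P x) = x) \<and> (\<forall>y\<in>W. P (S y) = y) \<and>
      (\<forall>y. norm (S y) \<le> 2 * (2 * (1 + L)) * norm y)"
    using L by (intro projection_section W(1) W'(1) dim_ge P half) auto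
  then obtain S where S: "linear S" "\<And>x. x \<in> W' \<Longrightarrow> S (P x) = x" "\<And>y. y \<in> W \<Longrightarrow> P (S y) = y"
    "\<And>y. norm (S y) \<le> 2 * (2 * (1 + L)) * norm y"
    by metis
  \<comment> \<open>For \<open>y\<close> in \<open>W\<close>, \<open>S y\<close> is the point of
    \<open>W'\<close> above \<open>y\<close>, so that \<open>W'\<close> is the graph of \<Lambda>
    over \<open>W\<close>.\<close>
  define \<Lambda> where "\<Lambda> = (\<lambda>y. S y - P y)"
  have lin: "linear \<Lambda>"
    unfolding \<Lambda>_def using S(1) P(1) by (rule linear_compose_sub)
  have \<Lambda>_le: "norm (\<Lambda> y) \<le> 5 * (1 + L) * norm y" for y
  proof -
    have "norm (\<Lambda> y) \<le> 2 * (2 * (1 + L)) * norm y + norm y"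
      unfolding \<Lambda>_def using norm_triangle_ineq4[of "S y" "P y"] S(4)[of y] P(5)[of y] by linarith
    also have "\<dots> \<le> 5 * (1 + L) * norm y"
      using L by (simp add: algebra_simps)
    finally show ?thesis .
  qed
  have \<Lambda>_orth: "(\<Lambda> y, 0) \<in> orthogonal_comp V" if "y \<in> W" for y
  proof -
    have "S y - P y = S y - P (S y)"
      using that S(3) P(4) by simp
    then have "fst v \<bullet> \<Lambda> y = 0" if "v \<in> V" for v
      using P(3)[of "fst v" "S y"] that by (simp add: \<Lambda>_def W_def inner_commute)
    then show ?thesis
      by (simp add: orthogonal_comp_def orthogonal_def inner_prod_def)
  qed
  have on_B: "pnorm (g q - g p - (\<Lambda> (fst q - fst p), 0)) \<le> 6 * (1 + L) * \<kappa> * pnorm (q - p)"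
    if qB: "q \<in> B" for q
  proof -
    have qA: "q \<in> A" and qV: "q \<in> V" using qB B(1) A by auto
    obtain w where w: "w \<in> V'" "pnorm (z q - w) \<le> \<kappa> * pnorm (q - p)"
      using near[OF qB] by blast
    define y where "y = fst q - fst p"
    define e where "e = fst (z q) - fst w"
    have yW: "y \<in> W" using fstW[OF qV] by (simp add: y_def)
    have e: "norm e \<le> \<kappa> * pnorm (q - p)"
      using norm_fst_le_pnorm[of "z q - w"] w(2) by (simp add: e_def)
    have "P (fst w) = y - P e"
      using Pz[OF qA] by (simp add: e_def y_def linear_diff[OF P(1)])
    moreover have "S (P (fst w)) = fst w"
      using w(1) by (intro S(2)) (simp add: W'_def)
    ultimately have "fst w = S y - S (P e)"
      by (simp add: linear_diff[OF S(1)])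
    moreover have "fst (g q - g p) = e + fst w - y"
      by (simp add: e_def z_def y_def)
    \<comment> \<open>If the chord lay in \<open>V'\<close>, \<Lambda> would be exact. The deviation
      \<open>e\<close> enters directly and through the correction of the base point, with factor
      \<open>1 + 4 * (1 + L)\<close>.\<close>
    ultimately have fe: "fst (g q - g p) - \<Lambda> y = e - S (P e)"
      unfolding \<Lambda>_def P(4)[OF yW] by simp
    have "norm (S (P e)) \<le> 4 * (1 + L) * norm e"
    proof -
      have "norm (S (P e)) \<le> 2 * (2 * (1 + L)) * norm (P e)" by (rule S(4))
      also have "\<dots> \<le> 2 * (2 * (1 + L)) * norm e"
        using P(5) L by (intro mult_left_mono) auto
      finally show ?thesis by simp
    qed
    then have "norm (fst (g q - g p) - \<Lambda> y) \<le> (1 + 4 * (1 + L)) * norm e"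
      unfolding fe using norm_triangle_ineq4[of e "S (P e)"] by (simp add: algebra_simps)
    also have "\<dots> \<le> (1 + 4 * (1 + L)) * (\<kappa> * pnorm (q - p))"
      using e L by (intro mult_left_mono) auto
    finally have space: "norm (fst (g q - g p) - \<Lambda> y) \<le> (1 + 4 * (1 + L)) * (\<kappa> * pnorm (q - p))" .
    have time: "\<bar>snd (g q - g p)\<bar> \<le> (\<kappa> * pnorm (q - p))\<^sup>2"
    proof (cases "\<forall>v\<in>V. snd v = 0")
      case True
      \<comment> \<open>A vertical \<open>V'\<close> would have a space part of dimension
        \<open>m - 2\<close>, too small for \<open>dim_le\<close>.\<close>
      have "snd w = 0"
        using W(3) W'(3) True dim_le w(1) subspace_0[OF subV] by fastforce
      then have "snd (z q - w) = snd (g q - g p)"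
        using True pV qV by (simp add: z_def)
      moreover have "(pnorm (z q - w))\<^sup>2 \<le> (\<kappa> * pnorm (q - p))\<^sup>2"
        using w(2) by (intro power_mono) auto
      ultimately show ?thesis
        using abs_snd_le_pnorm[of "z q - w"] by simp
    next
      case False
      then have vert: "\<forall>v\<in>V. \<forall>t. (fst v, t) \<in> V" using W(3) by blast
      then have "(0, 1) \<in> V" using subspace_0[OF subV] by fastforce
      then have "snd (g q) = 0" if "q \<in> A" for q
        using orth[OF that] by (cases "g q") fastforce
      then show ?thesis using qA pA by simp
    qed
    have "sqrt \<bar>snd (g q - g p)\<bar> \<le> \<kappa> * pnorm (q - p)"
      using time \<kappa> by (intro real_le_lsqrt) auto
    then have "pnorm (fst (g q - g p) - \<Lambda> y, snd (g q - g p)) \<le>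
        (1 + 4 * (1 + L)) * (\<kappa> * pnorm (q - p)) + \<kappa> * pnorm (q - p)"
      using space sqrt_add_le_add_sqrt[of "(norm (fst (g q - g p) - \<Lambda> y))\<^sup>2" "\<bar>snd (g q - g p)\<bar>"]
      by (simp add: pnorm_def)
    also have "\<dots> = (2 + 4 * (1 + L)) * (\<kappa> * pnorm (q - p))"
      by (simp add: algebra_simps)
    also have "\<dots> \<le> 6 * (1 + L) * (\<kappa> * pnorm (q - p))"
      using \<kappa> L by (intro mult_right_mono) auto
    finally have "pnorm (fst (g q - g p) - \<Lambda> y, snd (g q - g p)) \<le> 6 * (1 + L) * \<kappa> * pnorm (q - p)"
      by simp
    moreover have "(fst (g q - g p) - \<Lambda> y, snd (g q - g p)) = g q - g p - (\<Lambda> y, 0)"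
      by (simp add: prod_eq_iff)
    ultimately show ?thesis by (simp add: y_def)
  qed
  \<comment> \<open>Now density is used to pass from \<open>B\<close> to \<open>A\<close>:
    \<open>q\<close> is replaced by a point \<open>q'\<close> of \<open>B\<close> with error
    \<open>\<epsilon> * D\<close>. The cap 1 ensures that \<open>q'\<close> stays within
    \<open>2 * D\<close> of \<open>p\<close>.\<close>
  define \<epsilon>' where "\<epsilon>' = min \<epsilon> 1"
  have \<epsilon>': "0 < \<epsilon>'" "\<epsilon>' \<le> \<epsilon>" "\<epsilon>' \<le> 1" using \<epsilon>(1) by (auto simp: \<epsilon>'_def)
  obtain \<delta> where \<delta>: "0 < \<delta>" "\<And>v. v \<in> V \<Longrightarrow> v \<noteq> p \<Longrightarrow> pnorm (v - p) < \<delta> \<Longrightarrow>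
    \<exists>q\<in>B. pnorm (q - v) < \<epsilon>' * pnorm (v - p)"
    by (rule dense_pointD[OF B(3) \<epsilon>'(1) that])
  have "pnorm (g q - g p - (\<Lambda> (fst q - fst p), 0)) \<le> 18 * (1 + L)\<^sup>2 * \<epsilon> * pnorm (q - p)"
    if q: "q \<in> A" "pnorm (q - p) < \<delta>" for q
  proof (cases "q = p")
    case True
    then show ?thesis using linear_0[OF lin] by (simp flip: zero_prod_def)
  next
    case False
    define D where "D = pnorm (q - p)"
    have D: "0 \<le> D" by (simp add: D_def)
    obtain q' where q': "q' \<in> B" "pnorm (q' - q) < \<epsilon>' * D"
      using \<delta>(2)[OF subsetD[OF A q(1)] False q(2)] unfolding D_def by blast
    have "\<epsilon>' * D \<le> \<epsilon> * D" "\<epsilon>' * D \<le> 1 * D"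
      using \<epsilon>' D by (intro mult_right_mono; simp)+
    then have q'q: "pnorm (q - q') \<le> \<epsilon> * D" and q'D: "pnorm (q - q') \<le> D"
      using q'(2) pnorm_minus_commute[of q q'] by auto
    have "pnorm (q' - p) \<le> 2 * D"
      using pnorm_diff_triangle[of q' p q] q'D pnorm_minus_commute[of q q'] by (simp add: D_def)
    then have "6 * (1 + L) * \<kappa> * pnorm (q' - p) \<le> 6 * (1 + L) * \<kappa> * (2 * D)"
      using \<kappa> L by (intro mult_left_mono) auto
    also have "\<dots> = 12 * (1 + L) * \<kappa> * D" by simp
    finally have 1: "pnorm (g q' - g p - (\<Lambda> (fst q' - fst p), 0)) \<le> 12 * (1 + L) * \<kappa> * D"
      using on_B[OF q'(1)] by linarith
    have "pnorm (g q - g q') \<le> L * pnorm (q - q')"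
      using lip q(1) q'(1) B(1) by (auto simp: parabolic_lipschitz_def)
    also have "\<dots> \<le> L * (\<epsilon> * D)" using q'q L by (intro mult_left_mono)
    finally have 2: "pnorm (g q - g q') \<le> L * (\<epsilon> * D)" .
    have "norm (\<Lambda> (fst q - fst q')) \<le> 5 * (1 + L) * norm (fst (q - q'))"
      using \<Lambda>_le by simp
    also have "\<dots> \<le> 5 * (1 + L) * (\<epsilon> * D)"
      using norm_fst_le_pnorm[of "q - q'"] q'q L by (intro mult_left_mono) auto
    finally have 3: "pnorm (\<Lambda> (fst q - fst q'), 0::real) \<le> 5 * (1 + L) * (\<epsilon> * D)" by simp
    have eq: "g q - g p - (\<Lambda> (fst q - fst p), 0) =
        (g q' - g p - (\<Lambda> (fst q' - fst p), 0)) + ((g q - g q') - (\<Lambda> (fst q - fst q'), 0))"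
      by (simp add: prod_eq_iff linear_diff[OF lin])
    have "pnorm (g q - g p - (\<Lambda> (fst q - fst p), 0)) \<le>
        12 * (1 + L) * \<kappa> * D + (L * (\<epsilon> * D) + 5 * (1 + L) * (\<epsilon> * D))"
      unfolding eq using 1 2 3 pnorm_add[of "g q' - g p - (\<Lambda> (fst q' - fst p), 0)" "(g q - g q') - (\<Lambda> (fst q - fst q'), 0)"]
        pnorm_triangle_diff[of "g q - g q'" "(\<Lambda> (fst q - fst q'), 0)"] by linarith
    also have "\<dots> = (12 * (1 + L)\<^sup>2 + L + 5 * (1 + L)) * (\<epsilon> * D)"
      by (simp add: \<kappa>_def algebra_simps power2_eq_square)
    also have "\<dots> \<le> 18 * (1 + L)\<^sup>2 * (\<epsilon> * D)"
      using L \<epsilon>(1) D by (intro mult_right_mono) (simp_all add: power2_eq_square algebra_simps)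
    finally show ?thesis by (simp add: D_def)
  qed
  then show ?thesis
    using lin \<Lambda>_le \<Lambda>_orth \<delta>(1) by (intro exI[of _ \<Lambda>]) (auto simp: W_def)
qed

text \<open>By finite dimension, a subsequence of the uniformly bounded maps converges to some
  \<open>l\<close>. The relative error of \<open>l\<close> is at most \<open>c k\<close> plus the
  distance of the two maps, which tends to 0. As the values are horizontal, the parabolic operator
  norm is finite.\<close>

lemma parabolically_differentiableI_approx:
  fixes V A :: "'n::finite parabolic set"
  assumes c: "c \<longlonglongrightarrow> 0"
    and approx: "\<And>k. \<exists>\<Lambda>. linear \<Lambda> \<and> (\<forall>y. norm (\<Lambda> y) \<le> K * norm y) \<and>
      (\<forall>y\<in>fst ` V. (\<Lambda> y, 0) \<in> orthogonal_comp V) \<and>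
      (\<exists>d>0. \<forall>q\<in>A. pnorm (q - p) < d \<longrightarrow>
         pnorm (g q - g p - (\<Lambda> (fst q - fst p), 0)) \<le> c k * pnorm (q - p))"
  shows "parabolically_differentiable V A g p"
proof -
  obtain \<Lambda> where \<Lambda>: "\<And>k. linear (\<Lambda> k)" "\<And>k y. norm (\<Lambda> k y) \<le> K * norm y"
    "\<And>k y. y \<in> fst ` V \<Longrightarrow> (\<Lambda> k y, 0) \<in> orthogonal_comp V"
    "\<And>k. \<exists>d>0. \<forall>q\<in>A. pnorm (q - p) < d \<longrightarrow>
         pnorm (g q - g p - (\<Lambda> k (fst q - fst p), 0)) \<le> c k * pnorm (q - p)"
    using approx by metis
  \<comment> \<open>In the type of bounded linear maps, the operator norm is available and bounded
    sequences have convergent subsequences.\<close>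
  define F where "F = (\<lambda>k. Blinfun (\<Lambda> k))"
  have F: "blinfun_apply (F k) = \<Lambda> k" for k
    unfolding F_def using \<Lambda>(1) by (intro bounded_linear_Blinfun_apply) (simp add: linear_conv_bounded_linear)
  have "norm (F k) \<le> max K 0" for k
  proof (rule norm_blinfun_bound)
    show "norm (F k y) \<le> max K 0 * norm y" for y
      using \<Lambda>(2)[of k y] mult_right_mono[of K "max K 0" "norm y"] by (simp add: F)
  qed simp
  then have "bounded (range F)" by (auto simp: bounded_iff)
  then obtain l s where s: "strict_mono (s :: nat \<Rightarrow> nat)" "(F \<circ> s) \<longlonglongrightarrow> l"
    using bounded_imp_convergent_subsequence by blast
  have lim: "(\<lambda>k. \<Lambda> (s k) y) \<longlonglongrightarrow> l y" for y
    using blinfun.tendsto[OF s(2) tendsto_const[of y]] by (simp add: F)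
  have l_orth: "(l y, 0) \<in> orthogonal_comp V" if "y \<in> fst ` V" for y
    unfolding orthogonal_comp_def orthogonal_def
  proof (intro CollectI ballI)
    fix v assume "v \<in> V"
    then have "fst v \<bullet> \<Lambda> (s k) y = 0" for k
      using \<Lambda>(3)[OF that, of "s k"] by (auto simp: orthogonal_comp_def orthogonal_def inner_prod_def)
    then have "(\<lambda>k. 0) \<longlonglongrightarrow> fst v \<bullet> l y"
      using tendsto_inner[OF tendsto_const[of "fst v"] lim[of y]] by simp
    then have "fst v \<bullet> l y = 0"
      by (simp add: LIMSEQ_const_iff)
    then show "v \<bullet> (l y, 0) = 0" by (simp add: inner_prod_def)
  qed
  define D where "D = (\<lambda>v :: 'n parabolic. (l (fst v), 0::real))"
  have est: "\<exists>d>0. \<forall>q\<in>A. q \<noteq> p \<and> pdist q p < d \<longrightarrow>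
      pnorm (g q - g p - D (fst q - fst p, 0)) / pnorm (q - p) < e" if "0 < e" for e
  proof -
    have "(\<lambda>k. c (s k) + norm (F (s k) - l)) \<longlonglongrightarrow> 0 + norm (l - l)"
      using s(2) LIMSEQ_subseq_LIMSEQ[OF c s(1)] by (intro tendsto_intros) (simp_all add: o_def)
    then have "eventually (\<lambda>k. c (s k) + norm (F (s k) - l) < e) sequentially"
      using that by (intro order_tendstoD) auto
    then obtain k where k: "c (s k) + norm (F (s k) - l) < e"
      by (auto simp: eventually_sequentially)
    obtain d where d: "d > 0" "\<forall>q\<in>A. pnorm (q - p) < d \<longrightarrow>
         pnorm (g q - g p - (\<Lambda> (s k) (fst q - fst p), 0)) \<le> c (s k) * pnorm (q - p)"
      using \<Lambda>(4) by blast
    show ?thesis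
    proof (intro exI[of _ d] conjI ballI impI)
      fix q assume "q \<in> A" and q: "q \<noteq> p \<and> pdist q p < d"
      let ?y = "fst q - fst p"
      have 1: "pnorm (g q - g p - (\<Lambda> (s k) ?y, 0)) \<le> c (s k) * pnorm (q - p)"
        using d(2) \<open>q \<in> A\<close> q by (simp add: pdist_def)
      have "norm ((F (s k) - l) ?y) \<le> norm (F (s k) - l) * norm ?y"
        by (rule norm_blinfun)
      also have "\<dots> \<le> norm (F (s k) - l) * pnorm (q - p)"
        using norm_fst_le_pnorm[of "q - p"] by (intro mult_left_mono) auto
      finally have 2: "pnorm (\<Lambda> (s k) ?y - l ?y, 0::real) \<le> norm (F (s k) - l) * pnorm (q - p)"
        by (simp add: F blinfun.diff_left)
      have eq: "g q - g p - D (?y, 0) = (g q - g p - (\<Lambda> (s k) ?y, 0)) + (\<Lambda> (s k) ?y - l ?y, 0)"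
        by (simp add: D_def prod_eq_iff)
      have "pnorm (g q - g p - D (?y, 0)) \<le> (c (s k) + norm (F (s k) - l)) * pnorm (q - p)"
        unfolding eq distrib_right using 1 2 pnorm_add[of "g q - g p - (\<Lambda> (s k) ?y, 0)" "(\<Lambda> (s k) ?y - l ?y, 0)"]
        by linarith
      moreover have "0 < pnorm (q - p)" using q by simp
      ultimately have "pnorm (g q - g p - D (?y, 0)) / pnorm (q - p) \<le> c (s k) + norm (F (s k) - l)"
        by (simp only: pos_divide_le_eq)
      then show "pnorm (g q - g p - D (?y, 0)) / pnorm (q - p) < e"
        using k by linarith
    qed (rule d(1))
  qed
  show ?thesis
    unfolding parabolically_differentiable_def
  proof (intro exI[of _ D] conjI)
    show "D \<in> V \<inter> horizontal \<rightarrow> orthogonal_comp V"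
      using l_orth by (auto simp: D_def)
    show "linear_map_on (V \<inter> horizontal) D"
      by (auto simp: linear_map_on_def D_def blinfun.add_right blinfun.scaleR_right)
    show "bdd_above ((\<lambda>v. pnorm (D v) / pnorm v) ` (V \<inter> horizontal - {0}))"
    proof (rule bdd_aboveI2[of _ _ "norm l"])
      fix v assume "v \<in> V \<inter> horizontal - {0}"
      then have "0 < pnorm v" by simp
      have "pnorm (D v) \<le> norm l * norm (fst v)"
        using norm_blinfun[of l "fst v"] by (simp add: D_def)
      also have "\<dots> \<le> norm l * pnorm v"
        by (intro mult_left_mono norm_fst_le_pnorm) simp
      finally show "pnorm (D v) / pnorm v \<le> norm l"
        using \<open>0 < pnorm v\<close> by (simp add: divide_le_eq)
    qed
    show "((\<lambda>q. pnorm (g q - g p - D (fst q - fst p, 0)) / pnorm (q - p)) \<longlongrightarrow> 0) (at p within A)"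
    proof (rule order_tendstoI)
      show "\<forall>\<^sub>F q in at p within A. pnorm (g q - g p - D (fst q - fst p, 0)) / pnorm (q - p) < e"
        if "0 < e" for e
        using est[OF that] unfolding eventually_at_within_parabolic .
      show "\<forall>\<^sub>F q in at p within A. e < pnorm (g q - g p - D (fst q - fst p, 0)) / pnorm (q - p)"
        if "e < 0" for e
        using that by (intro always_eventually allI less_le_trans[OF that]) simp
    qed
  qed
qed

section \<open>Differentiability almost everywhere\<close>

theorem theorem5p2:
  fixes m :: nat
    and V A :: "'n::finite parabolic set"
    and g :: "'n parabolic \<Rightarrow> 'n parabolic"
  assumes "0 < m" and "m < CARD('n) + 2"
    and "V \<in> planes m"
    and "A \<subseteq> V"
    and "g \<in> A \<rightarrow> orthogonal_comp V"
    and "hausdorff_measurable m A"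
    and "\<exists>L. parabolic_lipschitz L A g"
    and "LG_rectifiable m (graph_over A g)"
  shows "hausdorff m {p \<in> A. \<not> parabolically_differentiable V A g p} = 0"
proof -
  obtain L0 where L0: "parabolic_lipschitz L0 A g" using assms(7) by blast
  define L where "L = max L0 0"
  have L: "0 \<le> L" by (simp add: L_def)
  have lip: "parabolic_lipschitz L A g"
    unfolding parabolic_lipschitz_def
  proof (intro ballI)
    fix p q assume "p \<in> A" "q \<in> A"
    then have "pnorm (g p - g q) \<le> L0 * pnorm (p - q)"
      using L0 by (simp add: parabolic_lipschitz_def)
    also have "\<dots> \<le> L * pnorm (p - q)"
      by (intro mult_right_mono) (simp_all add: L_def)
    finally show "pnorm (g p - g q) \<le> L * pnorm (p - q)" .
  qed
  \<comment> \<open>The first bound meets the smallness condition of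
    \<open>approximate_differential\<close>, the second makes the errors tend to 0.\<close>
  define e where "e k = min (1 / (8 * (1 + L))) (1 / real (Suc k))" for k
  have e: "0 < e k" "e k * (1 + L) \<le> 1 / 8" "e k \<le> 1 / real (Suc k)" for k
  proof -
    show "0 < e k" "e k \<le> 1 / real (Suc k)" using L by (auto simp: e_def)
    have "e k * (1 + L) \<le> 1 / (8 * (1 + L)) * (1 + L)"
      using L by (intro mult_right_mono) (auto simp: e_def)
    also have "\<dots> = 1 / 8" using L by (simp add: field_simps)
    finally show "e k * (1 + L) \<le> 1 / 8" .
  qed
  have "\<exists>G :: nat \<Rightarrow> 'n parabolic set. (\<forall>i. lipschitz_graph m (e k) (G i)) \<and>
      hausdorff m (graph_over A g - (\<Union>i. G i)) = 0" for k
    using assms(8) e(1) unfolding LG_rectifiable_def by blast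
  then obtain G where G: "\<And>k i :: nat. lipschitz_graph m (e k) (G k i)"
    "\<And>k. hausdorff m (graph_over A g - (\<Union>i. G k i)) = 0"
    by metis
  obtain P where P: "linear P" "\<And>x. P x \<in> V" "\<And>v. v \<in> V \<Longrightarrow> P v = v"
    "\<And>w. w \<in> orthogonal_comp V \<Longrightarrow> P w = 0" "\<And>x. x - P x \<in> orthogonal_comp V"
    "\<And>x. pnorm (P x) \<le> pnorm x" "\<And>x. pnorm (x - P x) \<le> pnorm x"
    using plane_projection[OF assms(3)] by blast
  have Pgraph: "P (p + g p) = p" if "p \<in> A" for p
  proof -
    have "P p = p" "P (g p) = 0" using that assms(4,5) P(3,4) by blast+
    then show ?thesis by (simp add: linear_add[OF P(1)])
  qed
  define B where "B k i = {p \<in> A. p + g p \<in> G k i}" for k i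
  \<comment> \<open>The exceptional set at level \<open>k\<close>: base points whose graph points
    escape all \<open>G k i\<close>, null because \<open>P\<close> is a contraction, and points at
    which a piece \<open>B k i\<close> fails to be dense.\<close>
  define N where "N k = P ` (graph_over A g - (\<Union>i. G k i)) \<union> (\<Union>i. {p \<in> B k i. \<not> dense_point V (B k i) p})" for k
  have "hausdorff m (N k) = 0" for k
    unfolding N_def
  proof (intro hausdorff_0_Un hausdorff_0_UN)
    show "hausdorff m (P ` (graph_over A g - (\<Union>i. G k i))) = 0"
      using G(2) P(6) by (intro hausdorff_0_image) (simp_all flip: linear_diff[OF P(1)])
    show "hausdorff m {p \<in> B k i. \<not> dense_point V (B k i) p} = 0" for i
      using assms(4) by (intro almost_all_dense_points assms(3)) (auto simp: B_def)
  qed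
  then have null: "hausdorff m (\<Union>k. N k) = 0" by (rule hausdorff_0_UN)
  have "parabolically_differentiable V A g p" if p: "p \<in> A" "p \<notin> (\<Union>k. N k)" for p
  proof (rule parabolically_differentiableI_approx)
    have "(\<lambda>k. 18 * (1 + L)\<^sup>2 * e k) \<longlonglongrightarrow> 18 * (1 + L)\<^sup>2 * 0"
    proof (intro tendsto_intros)
      show "e \<longlonglongrightarrow> 0"
        using e(1,3) LIMSEQ_inverse_real_of_nat
        by (intro real_tendsto_sandwich[of "\<lambda>_. 0" e sequentially "\<lambda>k. 1 / real (Suc k)"])
          (auto simp: inverse_eq_divide intro!: always_eventually less_imp_le)
    qed
    then show "(\<lambda>k. 18 * (1 + L)\<^sup>2 * e k) \<longlonglongrightarrow> 0" by simp
    fix k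
    have "p + g p \<in> graph_over A g" using p(1) unfolding graph_over_def by blast
    moreover have "p \<notin> P ` (graph_over A g - (\<Union>i. G k i))" using p(2) by (auto simp: N_def)
    ultimately have "p + g p \<in> (\<Union>i. G k i)" using Pgraph[OF p(1)] by (metis DiffI imageI)
    then obtain i where i: "p \<in> B k i" using p(1) by (auto simp: B_def)
    then have dense: "dense_point V (B k i) p" using p(2) by (auto simp: N_def)
    have BA: "B k i \<subseteq> A" and BG: "\<And>q. q \<in> B k i \<Longrightarrow> q + g q \<in> G k i" by (auto simp: B_def)
    show "\<exists>\<Lambda>. linear \<Lambda> \<and> (\<forall>y. norm (\<Lambda> y) \<le> 5 * (1 + L) * norm y) \<and>
      (\<forall>y\<in>fst ` V. (\<Lambda> y, 0) \<in> orthogonal_comp V) \<and>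
      (\<exists>d>0. \<forall>q\<in>A. pnorm (q - p) < d \<longrightarrow>
         pnorm (g q - g p - (\<Lambda> (fst q - fst p), 0)) \<le> 18 * (1 + L)\<^sup>2 * e k * pnorm (q - p))"
      by (rule approximate_differential[OF assms(3,4,5) lip L BA i dense G(1) BG e(1,2)])
  qed
  then have "{p \<in> A. \<not> parabolically_differentiable V A g p} \<subseteq> (\<Union>k. N k)" by blast
  with null show ?thesis by (rule hausdorff_0_mono)
qed

end
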